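(* Let $(\Omega,\mathcal F,P)$ be a probability space carrying a uniformly distributed $[0,1]$-valued random variable, let $X$ be a real Banach space and let $Z$ be an $X^*$-valued, Bochner integrable random variable on $(\Omega,\mathcal F,P)$ such that $\mathbb E\|Z\|=1$. Put $\sigma_Z:=F_{\|Z\|}^{-1}$. Then, for every $p\in[1,\infty)$, $$\rho_Z:L_{\sigma_Z}^p(P,X)\to\mathbb R,\qquad Y\mapsto\sup\{\mathbb E\langle Z,Y'\rangle:\ Y'\sim Y\}$$ is a well-defined subadditive, convex functional. Moreover, for all $Y_1,Y_2\in L_{\sigma_Z}^p(P,X)$, $$|\rho_Z(Y_1)-\rho_Z(Y_2)|\le\|Y_1-Y_2\|_{\sigma_Z,p}.$$
   Context: $\mathscr U(0,1)$ denotes the set of all $[0,1]$-valued random variables $U$ on $(\Omega,\mathcal F,P)$ with $P(U\le u)=u$ for all $u\in[0,1]$. A distortion function is a nondecreasing, left-continuous function $\sigma:[0,1)\to[0,\infty)$ with $\int_0^1\sigma(u)\,du=1$. For a real random variable $W$, $F_W(q)=P(W\le q)$ and $F_W^{-1}(\alpha)=\inf\{q: F_W(q)\ge\alpha\}$; the function $\sigma_Z=F_{\|Z\|}^{-1}$ is a distortion function (its value at $0$ is immaterial and may be taken to be $0$). For a distortion function $\sigma$ and strongly measurable $Y:\Omega\to X$, $\|Y\|_{\sigma,p}^p:=\sup_{U\in\mathscr U(0,1)}\mathbb E\big(\sigma(U)\|Y\|^p\big)$, and $L_\sigma^p(P,X)$ is the space of (a.e.-classes of) strongly measurable $Y:\Omega\to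 X$ with $\|Y\|_{\sigma,p}<\infty$. $\langle x^*,x\rangle:=x^*(x)$ for $x^*\in X^*$, $x\in X$, and $\|\cdot\|$ also denotes the dual norm on $X^*$. For strongly measurable $X$-valued $Y,Y'$ on $(\Omega,\mathcal F,P)$, $Y\sim Y'$ means that $Y$ and $Y'$ have the same law, $P^{Y}=P^{Y'}$. *)

theory Defs
  imports "HOL-Probability.Probability"
begin

(* The library's integrable and borel_measurable-based Bochner theory asks for a second countable
   codomain; the Banach space here need not be separable, so strong measurability and Bochner
   integrability are defined directly. The limit is taken everywhere on space M, so that a strongly
   measurable function is Borel measurable and its law distr M borel f makes sense even if M is
   not complete. *)
definition strongly_measurable :: "'w measure \<Rightarrow> ('w \<Rightarrow> 'b::real_normed_vector) \<Rightarrow> bool" where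
  "strongly_measurable M f \<longleftrightarrow>
     (\<exists>s. (\<forall>i. simple_function M (s i)) \<and> (\<forall>\<omega>\<in>space M. (\<lambda>i. s i \<omega>) \<longlonglongrightarrow> f \<omega>))"

definition bochner_integrable :: "'w measure \<Rightarrow> ('w \<Rightarrow> 'b::real_normed_vector) \<Rightarrow> bool" where
  "bochner_integrable M f \<longleftrightarrow> strongly_measurable M f \<and>
     (\<exists>s. (\<forall>i. Bochner_Integration.simple_bochner_integrable M (s i)) \<and>
          (\<lambda>i. \<integral>\<^sup>+\<omega>. ennreal (norm (f \<omega> - s i \<omega>)) \<partial>M) \<longlonglongrightarrow> 0)"

definition uniform_rvs :: "'w measure \<Rightarrow> ('w \<Rightarrow> real) set" where
  "uniform_rvs M = {U. U \<in> borel_measurable M \<and> (\<forall>\<omega>\<in>space M. U \<omega> \<in> {0..1}) \<and>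
     (\<forall>u\<in>{0..1}. measure M {\<omega>\<in>space M. U \<omega> \<le> u} = u)}"

definition quantile :: "'w measure \<Rightarrow> ('w \<Rightarrow> real) \<Rightarrow> real \<Rightarrow> real" where
  "quantile M W \<alpha> = Inf {q. \<alpha> \<le> cdf (distr M borel W) q}"

(* The infimum is a genuine one only for levels strictly between 0 and 1; the two end points,
   which a uniform variable hits with probability 0, get the value 0. *)
definition sigma_of :: "'w measure \<Rightarrow> ('w \<Rightarrow> 'b::real_normed_vector) \<Rightarrow> real \<Rightarrow> real" where
  "sigma_of M Z u = (if 0 < u \<and> u < 1 then quantile M (\<lambda>\<omega>. norm (Z \<omega>)) u else 0)"

definition sigma_norm_pow ::
  "'w measure \<Rightarrow> (real \<Rightarrow> real) \<Rightarrow> real \<Rightarrow> ('w \<Rightarrow> 'b::real_normed_vector) \<Rightarrow> ennreal" where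
  "sigma_norm_pow M \<sigma> p Y =
     (SUP U\<in>uniform_rvs M. \<integral>\<^sup>+\<omega>. ennreal (\<sigma> (U \<omega>) * norm (Y \<omega>) powr p) \<partial>M)"

definition sigma_norm ::
  "'w measure \<Rightarrow> (real \<Rightarrow> real) \<Rightarrow> real \<Rightarrow> ('w \<Rightarrow> 'b::real_normed_vector) \<Rightarrow> ennreal" where
  "sigma_norm M \<sigma> p Y =
     (if sigma_norm_pow M \<sigma> p Y = \<infinity> then \<infinity>
      else ennreal (enn2real (sigma_norm_pow M \<sigma> p Y) powr (1 / p)))"

(* Representatives rather than almost-everywhere classes. *)
definition L_sigma ::
  "'w measure \<Rightarrow> (real \<Rightarrow> real) \<Rightarrow> real \<Rightarrow> ('w \<Rightarrow> 'b::real_normed_vector) set" where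
  "L_sigma M \<sigma> p = {Y. strongly_measurable M Y \<and> sigma_norm M \<sigma> p Y < \<infinity>}"

definition same_law_class ::
  "'w measure \<Rightarrow> ('w \<Rightarrow> 'b::real_normed_vector) \<Rightarrow> ('w \<Rightarrow> 'b) set" where
  "same_law_class M Y = {Y'. strongly_measurable M Y' \<and> distr M borel Y' = distr M borel Y}"

definition rho_values ::
  "'w measure \<Rightarrow> ('w \<Rightarrow> ('b::real_normed_vector \<Rightarrow>\<^sub>L real)) \<Rightarrow> ('w \<Rightarrow> 'b) \<Rightarrow> real set" where
  "rho_values M Z Y =
     (\<lambda>Y'. \<integral>\<omega>. blinfun_apply (Z \<omega>) (Y' \<omega>) \<partial>M) ` same_law_class M Y"

definition rho ::
  "'w measure \<Rightarrow> ('w \<Rightarrow> ('b::real_normed_vector \<Rightarrow>\<^sub>L real)) \<Rightarrow> ('w \<Rightarrow> 'b) \<Rightarrow> real" where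
  "rho M Z Y = Sup (rho_values M Z Y)"

end

theory Submission
  imports Defs
begin

text \<open>
  No randomisation independent of the given variables is available, only a uniform variable, but
  this makes the space atomless. Hence if \<open>N, N'\<close> are countably valued with the same law and \<open>W\<close> is
  strongly measurable, there is \<open>W'\<close> with \<open>(N', W') \<sim> (N, W)\<close>. Taking for \<open>N, N'\<close> the cells of a
  countable partition into small sets, every \<open>Y' \<sim> a Y\<^sub>1 + b Y\<^sub>2\<close> is uniformly close to some
  \<open>a Y\<^sub>1' + b Y\<^sub>2'\<close> with \<open>(Y\<^sub>1', Y\<^sub>2') \<sim> (Y\<^sub>1, Y\<^sub>2)\<close>, which gives subadditivity and convexity. The same
  device, applied to the cells of \<open>\<parallel>Z\<parallel>\<close> and of \<open>\<parallel>Y\<parallel>\<close> with \<open>W\<close> uniform, yields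
  \<open>E \<parallel>Z\<parallel> \<parallel>Y'\<parallel> \<le> sup\<^sub>U E \<sigma>\<^sub>Z(U) \<parallel>Y\<parallel>\<close> for \<open>Y' \<sim> Y\<close>, and Jensen's inequality for the probability
  \<open>\<sigma>\<^sub>Z(U) dP\<close> bounds the right-hand side by the norm of \<open>Y\<close>. The Lipschitz estimate follows from
  subadditivity.
\<close>

section \<open>Monotone coupling on an atomless probability space\<close>

text \<open>Without atoms the distribution function is continuous, so it cannot jump over the level
  \<open>u\<close>: it is at most \<open>u\<close> to the left of \<open>I u\<close>, and the limit
  at \<open>I u\<close> inherits this bound.\<close>

lemma (in cdf_distribution) cdf_pseudoinverse:
  assumes "\<And>x. measure M {x} = 0" and u: "0 < u" "u < 1"
  shows "C (I u) = u"
proof (rule antisym)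
  show "u \<le> C (I u)"
    using pseudoinverse'[rule_format, of u "I u"] u by simp
  have "isCont C (I u)"
    using assms by (simp add: isCont_cdf)
  then have lim: "(C \<longlongrightarrow> C (I u)) (at_left (I u))"
    unfolding isCont_def by (rule tendsto_within_subset) auto
  have "C x \<le> u" if "x < I u" for x
    using pseudoinverse'[rule_format, of u x] u that by auto
  then have "\<forall>\<^sub>F x in at_left (I u). C x \<le> u"
    unfolding eventually_at_left_field by (intro exI[of _ "I u - 1"]) auto
  then show "C (I u) \<le> u"
    using lim by (intro tendsto_upperbound) auto
qed

text \<open>Feeding \<open>R\<close> through its own distribution function gives a uniform variable,
  and the quantile function of \<open>V\<close> turns that into \<open>V'\<close>. The map from
  \<open>R\<close> to \<open>V'\<close> is nondecreasing almost surely, so thresholds at which the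
  two distribution functions agree cut out the same events; these thresholds will later mark the
  blocks of a countable index.\<close>

lemma (in prob_space) quantile_coupling:
  fixes R V :: "'a \<Rightarrow> real"
  assumes [measurable]: "R \<in> borel_measurable M" "V \<in> borel_measurable M"
    and atomless: "\<And>x. prob {\<omega>\<in>space M. R \<omega> = x} = 0"
  obtains V' where "V' \<in> borel_measurable M" "distr M borel V' = distr M borel V"
    "\<And>q. prob {\<omega>\<in>space M. R \<omega> \<le> q} = prob {\<omega>\<in>space M. V \<omega> \<le> q} \<Longrightarrow>
      AE \<omega> in M. V' \<omega> \<le> q \<longleftrightarrow> R \<omega> \<le> q"
proof -
  interpret A: cdf_distribution "distr M borel R"
    unfolding cdf_distribution_def by simp
  interpret B: cdf_distribution "distr M borel V"
    unfolding cdf_distribution_def by simp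
  let ?\<Omega> = "restrict_space lborel {0<..<1::real}"
  have CI: "A.C (A.I u) = u" if "0 < u" "u < 1" for u
  proof (rule A.cdf_pseudoinverse[OF _ that])
    fix x
    show "measure (distr M borel R) {x} = 0"
      using atomless[of x] by (subst measure_distr) (auto simp: vimage_def Int_def conj_commute)
  qed
  define G where "G \<omega> = A.C (R \<omega>)" for \<omega>
  \<comment> \<open>The infimum is a genuine one only on the open unit interval. The cut-off makes
    \<open>J\<close> Borel on the whole line, and \<open>G\<close> almost surely stays inside the
    interval.\<close>
  define J where "J u = (if 0 < u \<and> u < 1 then B.I u else 0)" for u :: real
  have C[measurable]: "A.C \<in> borel_measurable borel"
    using A.measurable_C by simp
  have I[measurable]: "A.I \<in> borel_measurable ?\<Omega>" "B.I \<in> borel_measurable ?\<Omega>"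
    using A.measurable_CI B.measurable_CI by (simp_all add: measurable_def sets_restrict_space space_restrict_space)
  have J[measurable]: "J \<in> borel_measurable borel"
    unfolding J_def using B.measurable_CI
    by (subst (asm) measurable_restrict_space_iff[where c=0]) (auto simp: greaterThanLessThan_def greaterThan_def lessThan_def Int_def cong: if_cong)
  have G[measurable]: "G \<in> borel_measurable M" unfolding G_def by measurable
  \<comment> \<open>\<open>R\<close> has the law of \<open>A.I\<close> under Lebesgue measure on the
    unit interval, and \<open>A.C\<close> undoes \<open>A.I\<close>; hence \<open>G\<close> is
    uniform there.\<close>
  have push: "distr M borel (\<lambda>\<omega>. H (G \<omega>)) = distr ?\<Omega> borel H"
    if H[measurable]: "H \<in> borel_measurable borel" for H :: "real \<Rightarrow> real"
  proof -
    have "distr M borel (\<lambda>\<omega>. H (G \<omega>)) = distr (distr M borel R) borel (\<lambda>x. H (A.C x))"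
      by (subst distr_distr) (auto simp: G_def o_def)
    also have "\<dots> = distr (distr ?\<Omega> borel A.I) borel (\<lambda>x. H (A.C x))"
      by (simp add: A.distr_I_eq_M)
    also have "\<dots> = distr ?\<Omega> borel (\<lambda>u. H (A.C (A.I u)))"
      by (subst distr_distr) (auto simp: o_def)
    also have "\<dots> = distr ?\<Omega> borel H"
      by (rule distr_cong) (auto simp: space_restrict_space CI)
    finally show ?thesis .
  qed
  have G01: "AE \<omega> in M. 0 < G \<omega> \<and> G \<omega> < 1"
  proof -
    have "AE u in distr ?\<Omega> borel (\<lambda>u. u). 0 < u \<and> u < 1"
      by (subst AE_distr_iff) (auto simp: AE_restrict_space_iff intro!: measurable_restrict_space1)
    moreover have "distr M borel G = distr ?\<Omega> borel (\<lambda>u. u)"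
      using push[of "\<lambda>u. u"] by simp
    ultimately have "AE u in distr M borel G. 0 < u \<and> u < 1"
      by metis
    then show ?thesis by (subst (asm) AE_distr_iff) auto
  qed
  define V' where "V' \<omega> = J (G \<omega>)" for \<omega>
  have V'[measurable]: "V' \<in> borel_measurable M" unfolding V'_def by measurable
  have law: "distr M borel V' = distr M borel V"
  proof -
    have "distr M borel V' = distr ?\<Omega> borel J"
      unfolding V'_def by (rule push) measurable
    also have "\<dots> = distr ?\<Omega> borel B.I"
      by (rule distr_cong) (auto simp: J_def space_restrict_space)
    finally show ?thesis using B.distr_I_eq_M by simp
  qed
  show ?thesis
  proof (rule that[OF V' law])
    fix q assume q: "prob {\<omega>\<in>space M. R \<omega> \<le> q} = prob {\<omega>\<in>space M. V \<omega> \<le> q}"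
    have cq: "A.C q = B.C q"
      using q by (simp add: cdf_def measure_distr vimage_def Int_def conj_commute)
    have 1: "AE \<omega> in M. R \<omega> \<le> q \<longrightarrow> V' \<omega> \<le> q"
      using G01
    proof eventually_elim
      case (elim \<omega>)
      show ?case
      proof
        assume "R \<omega> \<le> q"
        then have "G \<omega> \<le> B.C q"
          using A.cdf_nondecreasing[of "R \<omega>" q] cq by (simp add: G_def)
        then show "V' \<omega> \<le> q"
          using elim B.pseudoinverse'[rule_format, of "G \<omega>" q] by (simp add: V'_def J_def)
      qed
    qed
    \<comment> \<open>The converse implication comes from comparing masses: up to a null set the
      event for \<open>R\<close> is contained in the one for \<open>V'\<close>, and both have the
      same probability.\<close>
    have "prob {\<omega>\<in>space M. V' \<omega> \<le> q} = measure (distr M borel V') {..q}"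
      by (subst measure_distr) (auto simp: vimage_def Int_def conj_commute)
    also have "\<dots> = prob {\<omega>\<in>space M. V \<omega> \<le> q}"
      unfolding law by (subst measure_distr) (auto simp: vimage_def Int_def conj_commute)
    finally have 2: "prob {\<omega>\<in>space M. V' \<omega> \<le> q} = prob {\<omega>\<in>space M. R \<omega> \<le> q}"
      using q by simp
    have 3: "prob {\<omega>\<in>space M. R \<omega> \<le> q \<and> V' \<omega> \<le> q} = prob {\<omega>\<in>space M. R \<omega> \<le> q}"
      by (rule finite_measure_eq_AE) (use 1 in \<open>auto\<close>)
    have "prob ({\<omega>\<in>space M. V' \<omega> \<le> q} - {\<omega>\<in>space M. R \<omega> \<le> q \<and> V' \<omega> \<le> q}) = 0"
      by (subst finite_measure_Diff) (auto simp: 2 3)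
    moreover have "{\<omega>\<in>space M. V' \<omega> \<le> q} - {\<omega>\<in>space M. R \<omega> \<le> q \<and> V' \<omega> \<le> q}
      = {\<omega>\<in>space M. V' \<omega> \<le> q \<and> \<not> R \<omega> \<le> q}" by auto
    ultimately have "AE \<omega> in M. \<not> (V' \<omega> \<le> q \<and> \<not> R \<omega> \<le> q)"
      by (subst AE_iff_measurable[OF _ refl]) (auto simp: emeasure_eq_measure)
    with 1 show "AE \<omega> in M. V' \<omega> \<le> q \<longleftrightarrow> R \<omega> \<le> q"
      by eventually_elim auto
  qed
qed

text \<open>The point lies in the half-open interval from \<open>x - e\<close> to \<open>x\<close>,
  or \<open>x\<close> itself is below \<open>e\<close>; either way its mass is at most
  \<open>e\<close>. Taking for \<open>e\<close> half of that mass forces it to vanish.\<close>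

lemma (in prob_space) uniform_rvs_atomless:
  assumes U: "U \<in> uniform_rvs M"
  shows "prob {\<omega>\<in>space M. U \<omega> = x} = 0"
proof -
  have [measurable]: "U \<in> borel_measurable M" and U01: "\<And>\<omega>. \<omega> \<in> space M \<Longrightarrow> U \<omega> \<in> {0..1}"
    and Ucdf: "\<And>u. u \<in> {0..1} \<Longrightarrow> prob {\<omega>\<in>space M. U \<omega> \<le> u} = u"
    using U by (auto simp: uniform_rvs_def)
  show ?thesis
  proof (cases "x \<in> {0..1}")
    case False
    then have "{\<omega>\<in>space M. U \<omega> = x} = {}" using U01 by auto
    then show ?thesis by (simp only: measure_empty)
  next
    case True
    have "prob {\<omega>\<in>space M. U \<omega> = x} \<le> e" if "e > 0" for e
    proof (cases "x - e \<ge> 0")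
      case False
      have "prob {\<omega>\<in>space M. U \<omega> = x} \<le> prob {\<omega>\<in>space M. U \<omega> \<le> x}"
        by (rule finite_measure_mono) auto
      also have "\<dots> = x" using Ucdf True by auto
      finally show ?thesis using False by auto
    next
      case e: True
      have "prob {\<omega>\<in>space M. U \<omega> = x} \<le> prob ({\<omega>\<in>space M. U \<omega> \<le> x} - {\<omega>\<in>space M. U \<omega> \<le> x - e})"
        using that by (intro finite_measure_mono) auto
      also have "\<dots> = x - (x - e)"
        using that e True by (subst finite_measure_Diff) (auto simp: Ucdf)
      finally show ?thesis by simp
    qed
    from this[of "prob {\<omega>\<in>space M. U \<omega> = x} / 2"] show ?thesis
      using measure_nonneg[of M "{\<omega>\<in>space M. U \<omega> = x}"] by linarith
  qed
qed

text \<open>The factor 2 keeps the blocks from \<open>2 m\<close> to \<open>2 m + 1\<close> disjoint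
  even at \<open>v = 1\<close>; with factor 1, the right end of a block would be the left end of the
  next.\<close>

lemma double_add_unit_le_iff:
  fixes m n :: nat and v :: real
  assumes "v \<in> {0..1}"
  shows "2 * real m + v \<le> 2 * real n + 1 \<longleftrightarrow> m \<le> n"
proof (cases "m \<le> n")
  case True
  then have "real m \<le> real n" by simp
  then show ?thesis using assms True by simp
next
  case False
  then have "real (Suc n) \<le> real m" by (simp only: of_nat_le_iff)
  then show ?thesis using assms False by simp
qed

text \<open>This case carries the whole transfer of joint laws: Banach-valued variables are reduced
  to it by coding them as numbers in the unit interval.\<close>

lemma (in prob_space) lift_unit_interval:
  fixes N N' :: "'a \<Rightarrow> nat" and V :: "'a \<Rightarrow> real"
  assumes U: "U \<in> uniform_rvs M"
    and [measurable]: "N \<in> measurable M (count_space UNIV)" "N' \<in> measurable M (count_space UNIV)"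
      "V \<in> borel_measurable M"
    and V01: "\<And>\<omega>. \<omega> \<in> space M \<Longrightarrow> V \<omega> \<in> {0..1}"
    and law: "distr M (count_space UNIV) N' = distr M (count_space UNIV) N"
  obtains V' where "V' \<in> borel_measurable M"
    "distr M (count_space UNIV \<Otimes>\<^sub>M borel) (\<lambda>\<omega>. (N' \<omega>, V' \<omega>)) =
     distr M (count_space UNIV \<Otimes>\<^sub>M borel) (\<lambda>\<omega>. (N \<omega>, V \<omega>))"
proof -
  have [measurable]: "U \<in> borel_measurable M" and U01: "\<And>\<omega>. \<omega> \<in> space M \<Longrightarrow> U \<omega> \<in> {0..1}"
    using U by (auto simp: uniform_rvs_def)
  note Uatom = uniform_rvs_atomless[OF U]
  \<comment> \<open>\<open>R\<close> has no atoms, and the thresholds \<open>2 n + 1\<close> for \<open>R\<close> and \<open>T\<close> recover \<open>N'\<close> and \<open>N\<close> in order, so the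
    monotone coupling of \<open>T\<close> with \<open>R\<close> preserves the index.\<close>
  define R where "R \<omega> = 2 * real (N' \<omega>) + U \<omega>" for \<omega>
  define T where "T \<omega> = 2 * real (N \<omega>) + V \<omega>" for \<omega>
  have [measurable]: "R \<in> borel_measurable M" "T \<in> borel_measurable M"
    unfolding R_def T_def by measurable
  \<comment> \<open>\<open>R = x\<close> forces \<open>U = x - 2 n\<close> for some
    \<open>n\<close>, which is a countable union of null events.\<close>
  have Ratom: "prob {\<omega>\<in>space M. R \<omega> = x} = 0" for x
  proof -
    have "emeasure M (\<Union>n. {\<omega>\<in>space M. U \<omega> = x - 2 * real n}) = 0"
      by (rule emeasure_UN_eq_0) (auto simp: emeasure_eq_measure Uatom)
    moreover have "emeasure M {\<omega>\<in>space M. R \<omega> = x} \<le> emeasure M (\<Union>n. {\<omega>\<in>space M. U \<omega> = x - 2 * real n})"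
      by (rule emeasure_mono) (auto simp: R_def)
    ultimately show ?thesis by (simp add: measure_def)
  qed
  have R_iff: "R \<omega> \<le> 2 * real n + 1 \<longleftrightarrow> N' \<omega> \<le> n" if "\<omega> \<in> space M" for \<omega> n
    using double_add_unit_le_iff[OF U01[OF that]] by (simp add: R_def)
  have T_iff: "T \<omega> \<le> 2 * real n + 1 \<longleftrightarrow> N \<omega> \<le> n" if "\<omega> \<in> space M" for \<omega> n
    using double_add_unit_le_iff[OF V01[OF that]] by (simp add: T_def)
  obtain T' where T'[measurable]: "T' \<in> borel_measurable M"
    and T'law: "distr M borel T' = distr M borel T"
    and T'iff: "\<And>q. prob {\<omega>\<in>space M. R \<omega> \<le> q} = prob {\<omega>\<in>space M. T \<omega> \<le> q} \<Longrightarrow>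
      AE \<omega> in M. T' \<omega> \<le> q \<longleftrightarrow> R \<omega> \<le> q"
    using quantile_coupling[of R T] Ratom by auto
  have "AE \<omega> in M. T' \<omega> \<le> 2 * real n + 1 \<longleftrightarrow> N' \<omega> \<le> n" for n
  proof -
    have "prob {\<omega>\<in>space M. R \<omega> \<le> 2 * real n + 1} = prob {\<omega>\<in>space M. N' \<omega> \<le> n}"
      using R_iff by (intro arg_cong[where f=prob]) auto
    also have "\<dots> = measure (distr M (count_space UNIV) N') {..n}"
      by (subst measure_distr) (auto simp: vimage_def Int_def conj_commute)
    also have "\<dots> = prob {\<omega>\<in>space M. N \<omega> \<le> n}"
      unfolding law by (subst measure_distr) (auto simp: vimage_def Int_def conj_commute)
    also have "\<dots> = prob {\<omega>\<in>space M. T \<omega> \<le> 2 * real n + 1}"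
      using T_iff by (intro arg_cong[where f=prob]) auto
    finally show ?thesis
      using T'iff[of "2 * real n + 1"] AE_space by (auto simp: R_iff)
  qed
  then have AE1: "AE \<omega> in M. \<forall>n. T' \<omega> \<le> 2 * real n + 1 \<longleftrightarrow> N' \<omega> \<le> n"
    by (simp add: AE_all_countable)
  \<comment> \<open>\<open>h\<close> reads the index back from the real number, so one Borel map
    \<open>\<Phi>\<close> decodes the pair from \<open>T\<close> everywhere and from
    \<open>T'\<close> almost surely. Equality of the laws of \<open>T\<close> and \<open>T'\<close>
    thus passes to the pairs.\<close>
  define h :: "real \<Rightarrow> nat" where "h x = (LEAST n. x \<le> 2 * real n + 1)" for x
  have [measurable]: "h \<in> measurable borel (count_space UNIV)"
    unfolding h_def by measurable
  have hT': "AE \<omega> in M. h (T' \<omega>) = N' \<omega>"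
    using AE1 by eventually_elim (auto simp: h_def intro!: Least_equality)
  have hT: "h (T \<omega>) = N \<omega>" if "\<omega> \<in> space M" for \<omega>
    using that by (auto simp: h_def T_iff intro!: Least_equality)
  define \<Phi> where "\<Phi> x = (h x, x - 2 * real (h x))" for x
  have [measurable]: "\<Phi> \<in> measurable borel (count_space UNIV \<Otimes>\<^sub>M borel)"
    unfolding \<Phi>_def by measurable
  define V' where "V' \<omega> = T' \<omega> - 2 * real (N' \<omega>)" for \<omega>
  have V': "V' \<in> borel_measurable M" unfolding V'_def by measurable
  have "distr M (count_space UNIV \<Otimes>\<^sub>M borel) (\<lambda>\<omega>. (N' \<omega>, V' \<omega>))
      = distr M (count_space UNIV \<Otimes>\<^sub>M borel) (\<lambda>\<omega>. \<Phi> (T' \<omega>))"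
    by (rule distr_cong_AE) (use hT' V' in \<open>auto simp: \<Phi>_def V'_def\<close>)
  also have "\<dots> = distr (distr M borel T') (count_space UNIV \<Otimes>\<^sub>M borel) \<Phi>"
    by (subst distr_distr) (auto simp: o_def)
  also have "\<dots> = distr M (count_space UNIV \<Otimes>\<^sub>M borel) (\<lambda>\<omega>. \<Phi> (T \<omega>))"
    unfolding T'law by (subst distr_distr) (auto simp: o_def)
  also have "\<dots> = distr M (count_space UNIV \<Otimes>\<^sub>M borel) (\<lambda>\<omega>. (N \<omega>, V \<omega>))"
  proof (rule distr_cong)
    fix \<omega> assume "\<omega> \<in> space M"
    then show "\<Phi> (T \<omega>) = (N \<omega>, V \<omega>)"
      unfolding \<Phi>_def by (simp only: hT) (simp add: T_def)
  qed simp_all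
  finally show ?thesis using that V' by blast
qed

section \<open>Strong measurability\<close>

lemma strongly_measurable_borel:
  assumes "strongly_measurable M f"
  shows "f \<in> borel_measurable M"
proof -
  obtain s where s: "\<And>i. simple_function M (s i)" "\<And>\<omega>. \<omega> \<in> space M \<Longrightarrow> (\<lambda>i. s i \<omega>) \<longlonglongrightarrow> f \<omega>"
    using assms unfolding strongly_measurable_def by blast
  show ?thesis
    by (rule borel_measurable_LIMSEQ_metric[of s]) (use s in \<open>auto intro: borel_measurable_simple_function\<close>)
qed

lemma strongly_measurable_compose:
  assumes "strongly_measurable N f" "g \<in> measurable M N"
  shows "strongly_measurable M (\<lambda>x. f (g x))"
proof -
  obtain s where s: "\<And>i. simple_function N (s i)" "\<And>\<omega>. \<omega> \<in> space N \<Longrightarrow> (\<lambda>i. s i \<omega>) \<longlonglongrightarrow> f \<omega>"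
    using assms(1) unfolding strongly_measurable_def by blast
  have "simple_function M (\<lambda>x. s i (g x))" for i
    using simple_function_comp[OF assms(2) s(1)[of i]] by (simp add: o_def)
  then show ?thesis
    unfolding strongly_measurable_def
    using s(2) measurable_space[OF assms(2)] by (intro exI[of _ "\<lambda>i x. s i (g x)"]) auto
qed

text \<open>Applying \<open>h\<close> to simple approximants avoids the product sigma-algebra, which
  for nonseparable spaces can be strictly smaller than the Borel sigma-algebra of the
  product.\<close>

lemma strongly_measurable_continuous2:
  fixes h :: "'b::real_normed_vector \<Rightarrow> 'c::real_normed_vector \<Rightarrow> 'd::real_normed_vector"
  assumes f: "strongly_measurable M f" and g: "strongly_measurable M g"
    and h: "continuous_on UNIV (\<lambda>x. h (fst x) (snd x))"
  shows "strongly_measurable M (\<lambda>x. h (f x) (g x))"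
proof -
  obtain s where s: "\<And>i. simple_function M (s i)" "\<And>\<omega>. \<omega> \<in> space M \<Longrightarrow> (\<lambda>i. s i \<omega>) \<longlonglongrightarrow> f \<omega>"
    using f unfolding strongly_measurable_def by blast
  obtain t where t: "\<And>i. simple_function M (t i)" "\<And>\<omega>. \<omega> \<in> space M \<Longrightarrow> (\<lambda>i. t i \<omega>) \<longlonglongrightarrow> g \<omega>"
    using g unfolding strongly_measurable_def by blast
  have "(\<lambda>i. h (s i \<omega>) (t i \<omega>)) \<longlonglongrightarrow> h (f \<omega>) (g \<omega>)" if "\<omega> \<in> space M" for \<omega>
    using continuous_on_tendsto_compose[OF h tendsto_Pair[OF s(2)[OF that] t(2)[OF that]]] by simp
  moreover have "simple_function M (\<lambda>\<omega>. h (s i \<omega>) (t i \<omega>))" for i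
    by (rule simple_function_compose2[OF s(1) t(1)])
  ultimately show ?thesis
    unfolding strongly_measurable_def by (intro exI[of _ "\<lambda>i \<omega>. h (s i \<omega>) (t i \<omega>)"]) auto
qed

lemma strongly_measurable_continuous:
  fixes h :: "'b::real_normed_vector \<Rightarrow> 'd::real_normed_vector"
  assumes "strongly_measurable M f" "continuous_on UNIV h"
  shows "strongly_measurable M (\<lambda>x. h (f x))"
  by (rule strongly_measurable_continuous2[OF assms(1) assms(1), of "\<lambda>x _. h x"])
     (intro continuous_on_compose2[OF assms(2)] continuous_intros, auto)

lemma strongly_measurable_add_scaleR:
  assumes "strongly_measurable M f" "strongly_measurable M g"
  shows "strongly_measurable M (\<lambda>x. a *\<^sub>R f x + b *\<^sub>R g x)"
  by (rule strongly_measurable_continuous2[OF assms]) (intro continuous_intros)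

text \<open>Lets the joint law of two functions be handled as the law of a single function into the
  product space.\<close>

lemma strongly_measurable_Pair:
  assumes "strongly_measurable M f" "strongly_measurable M g"
  shows "strongly_measurable M (\<lambda>x. (f x, g x))"
  by (rule strongly_measurable_continuous2[OF assms]) (simp add: continuous_on_id)

section \<open>Coding a strongly measurable function by a real number\<close>

text \<open>Base 4 with digits 0 and 1 leaves a gap between the two cases of each digit, so every digit is
  a Borel function of the encoded number (no ambiguous expansions).\<close>

definition digit :: "nat \<Rightarrow> real set" where
  "digit n = {x. 1/4 \<le> frac (4 ^ n * x)}"

lemma digit_borel [measurable]: "digit n \<in> sets borel"
  unfolding digit_def frac_def by measurable

definition encode :: "(nat \<Rightarrow> bool) \<Rightarrow> real" where
  "encode b = (\<Sum>n. (1/4) * (1/4) ^ n * of_bool (b n))"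

lemma encode_summable: "summable (\<lambda>n. (1/4) * (1/4::real) ^ n * of_bool (b n))"
  by (rule summable_comparison_test[OF _ summable_mult[OF summable_geometric[of "1/4"], of "1/4"]]) auto

text \<open>The value 1/3 is the code with all digits 1. Being below 1, a code equals its own
  fractional part, and a tail divided by 4 stays below the digit threshold 1/4.\<close>

lemma encode_bounds: "0 \<le> encode b" "encode b \<le> 1/3"
proof -
  show "0 \<le> encode b"
    unfolding encode_def by (rule suminf_nonneg[OF encode_summable]) auto
  have "encode b \<le> (\<Sum>n. (1/4) * (1/4::real) ^ n)"
    unfolding encode_def
    by (rule suminf_le[OF _ encode_summable]) (auto intro!: summable_mult summable_geometric)
  also have "\<dots> = 1/3"
    by (subst suminf_mult) (auto simp: suminf_geometric)
  finally show "encode b \<le> 1/3" .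
qed

lemma encode_unfold: "4 * encode b = of_bool (b 0) + encode (\<lambda>n. b (Suc n))"
proof -
  have "encode b = (1/4) * of_bool (b 0) + (\<Sum>n. (1/4) * (1/4) ^ Suc n * of_bool (b (Suc n)))"
    unfolding encode_def using suminf_split_head[OF encode_summable[of b]] by simp
  also have "(\<Sum>n. (1/4) * (1/4) ^ Suc n * of_bool (b (Suc n)) :: real) = (1/4) * encode (\<lambda>n. b (Suc n))"
    unfolding encode_def by (subst suminf_mult[symmetric, OF encode_summable]) (simp add: algebra_simps)
  finally show ?thesis by simp
qed

text \<open>Induction that shifts the sequence: multiplying by 4 turns the leading digit into an
  integer summand, which \<open>frac\<close> discards.\<close>

lemma encode_in_digit: "encode b \<in> digit n \<longleftrightarrow> b n"
proof (induction n arbitrary: b)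
  case 0
  have "frac (encode b) = encode b"
    using encode_bounds[of b] by (simp add: frac_eq)
  then show ?case
    using encode_unfold[of b] encode_bounds[of "\<lambda>n. b (Suc n)"] by (cases "b 0") (auto simp: digit_def)
next
  case (Suc n)
  have "4 ^ Suc n * encode b = 4 ^ n * encode (\<lambda>n. b (Suc n)) + of_int (4 ^ n * of_bool (b 0))"
    using arg_cong[OF encode_unfold[of b], of "\<lambda>x. 4 ^ n * x"] by (simp add: algebra_simps)
  then have "frac (4 ^ Suc n * encode b) = frac (4 ^ n * encode (\<lambda>n. b (Suc n)))"
    by (metis frac_add_of_int_right)
  then show ?case
    using Suc.IH[of "\<lambda>n. b (Suc n)"] by (simp add: digit_def)
qed

text \<open>The simple approximants of \<open>W\<close> involve only countably many yes-or-no
  questions of the form \<open>s i \<omega> = x\<close>. All answers are stored as digits of one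
  number \<open>V \<omega>\<close>, from which every approximant, and then the limit, can be
  recovered.\<close>

lemma strongly_measurable_factor_real:
  fixes W :: "'a \<Rightarrow> 'c::banach"
  assumes "strongly_measurable M W"
  obtains V :: "'a \<Rightarrow> real" and f where "V \<in> borel_measurable M" "\<And>\<omega>. V \<omega> \<in> {0..1}"
    "strongly_measurable borel f" "\<And>\<omega>. \<omega> \<in> space M \<Longrightarrow> W \<omega> = f (V \<omega>)"
proof -
  obtain s where s: "\<And>i. simple_function M (s i)" "\<And>\<omega>. \<omega> \<in> space M \<Longrightarrow> (\<lambda>i. s i \<omega>) \<longlonglongrightarrow> W \<omega>"
    using assms unfolding strongly_measurable_def by blast
  define K where "K i = s i ` space M" for i
  have finK: "finite (K i)" for i
    using s(1) by (simp add: K_def simple_function_def)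
  \<comment> \<open>Digit number \<open>c i x\<close> stores whether the approximant
    \<open>s i\<close> takes the value \<open>x\<close>.\<close>
  define c where "c i x = prod_encode (i, to_nat_on (K i) x)" for i x
  define A where "A n = (let (i, j) = prod_decode n in {\<omega>\<in>space M. to_nat_on (K i) (s i \<omega>) = j})" for n
  have [measurable]: "A n \<in> sets M" for n
  proof -
    obtain i j where ij: "prod_decode n = (i, j)" by (cases "prod_decode n") auto
    have "simple_function M (\<lambda>\<omega>. to_nat_on (K i) (s i \<omega>))"
      by (rule simple_function_compose1[OF s(1)])
    from simple_functionD(2)[OF this, of "{j}"]
    show ?thesis by (simp add: A_def ij vimage_def Int_def conj_commute)
  qed
  define V where "V \<omega> = encode (\<lambda>n. \<omega> \<in> A n)" for \<omega>
  have V: "V \<in> borel_measurable M"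
    unfolding V_def encode_def by measurable
  have cA: "V \<omega> \<in> digit (c i x) \<longleftrightarrow> s i \<omega> = x" if "\<omega> \<in> space M" "x \<in> K i" for \<omega> i x
  proof -
    have "s i \<omega> \<in> K i" using that by (auto simp: K_def)
    with that show ?thesis
      using countable_finite[OF finK[of i]] by (auto simp: V_def encode_in_digit c_def A_def)
  qed
  \<comment> \<open>\<open>g i\<close> decodes the approximant \<open>s i\<close>: on a code
    \<open>V \<omega>\<close> with \<open>\<omega>\<close> in the space, exactly one value of
    \<open>K i\<close> has its digit set.\<close>
  define g where "g i v = (\<Sum>x\<in>K i. indicator (digit (c i x)) v *\<^sub>R x)" for i v
  have gV: "g i (V \<omega>) = s i \<omega>" if "\<omega> \<in> space M" for i \<omega>
  proof -
    have "g i (V \<omega>) = (\<Sum>x\<in>K i. if x = s i \<omega> then x else 0)"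
      unfolding g_def using that cA by (intro sum.cong) (auto simp: indicator_def)
    also have "\<dots> = s i \<omega>"
      using finK[of i] that by (auto simp: K_def)
    finally show ?thesis .
  qed
  have gs: "simple_function borel (g i)" for i
    unfolding g_def
    by (intro simple_function_sum simple_function_compose1[of _ _ "\<lambda>r. r *\<^sub>R _"] simple_function_indicator) auto
  \<comment> \<open>The Cauchy criterion with tolerances \<open>1 / Suc k\<close> uses countably
    many conditions, so \<open>E\<close> is Borel; by completeness it is the set where the decoded
    sequence converges.\<close>
  define E where "E = {v. \<forall>k. \<exists>n. \<forall>i\<ge>n. \<forall>j\<ge>n. dist (g i v) (g j v) < 1 / real (Suc k)}"
  have E_iff: "v \<in> E \<longleftrightarrow> convergent (\<lambda>i. g i v)" for v
  proof -
    have "v \<in> E \<longleftrightarrow> (\<forall>e>0. \<exists>n. \<forall>i\<ge>n. \<forall>j\<ge>n. dist (g i v) (g j v) < e)"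
    proof
      assume v: "v \<in> E"
      show "\<forall>e>0. \<exists>n. \<forall>i\<ge>n. \<forall>j\<ge>n. dist (g i v) (g j v) < e"
      proof (intro allI impI)
        fix e :: real assume "e > 0"
        then obtain k where k: "1 / real (Suc k) < e"
          using reals_Archimedean[of e] by (auto simp: inverse_eq_divide)
        obtain n where "\<forall>i\<ge>n. \<forall>j\<ge>n. dist (g i v) (g j v) < 1 / real (Suc k)"
          using v unfolding E_def by blast
        then show "\<exists>n. \<forall>i\<ge>n. \<forall>j\<ge>n. dist (g i v) (g j v) < e"
          using k by (meson less_trans)
      qed
    qed (simp add: E_def)
    then show ?thesis
      by (simp add: Cauchy_convergent_iff[symmetric] Cauchy_def)
  qed
  have [measurable]: "(\<lambda>v. dist (g i v) (g j v)) \<in> borel_measurable borel" for i j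
    by (intro borel_measurable_simple_function simple_function_compose2[OF gs gs])
  have E[measurable]: "E \<in> sets borel"
    unfolding E_def by measurable
  \<comment> \<open>The indicator makes the sequence vanish off \<open>E\<close>, so that it
    converges at every real number, as strong measurability of \<open>f\<close> on the whole line
    demands.\<close>
  define f where "f v = lim (\<lambda>i. indicator E v *\<^sub>R g i v)" for v
  have "strongly_measurable borel f"
    unfolding strongly_measurable_def
  proof (intro exI[of _ "\<lambda>i v. indicator E v *\<^sub>R g i v"] conjI allI ballI)
    show "simple_function borel (\<lambda>v. indicator E v *\<^sub>R g i v)" for i
      by (intro simple_function_compose2[OF _ gs, of "indicator E" "\<lambda>r x. r *\<^sub>R x"] simple_function_indicator E)
    show "(\<lambda>i. indicator E v *\<^sub>R g i v) \<longlonglongrightarrow> f v" for v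
      unfolding f_def convergent_LIMSEQ_iff[symmetric]
      by (cases "v \<in> E") (auto simp: E_iff convergent_const)
  qed
  moreover have "W \<omega> = f (V \<omega>)" if "\<omega> \<in> space M" for \<omega>
  proof -
    have "convergent (\<lambda>i. g i (V \<omega>))" "lim (\<lambda>i. g i (V \<omega>)) = W \<omega>"
      using s(2)[OF that] that by (auto simp: gV convergent_def limI)
    then show ?thesis by (simp add: f_def E_iff)
  qed
  moreover have "V \<omega> \<in> {0..1}" for \<omega>
    using encode_bounds[of "\<lambda>n. \<omega> \<in> A n"] by (simp add: V_def)
  ultimately show ?thesis using that V by blast
qed

section \<open>Lifting joint laws along a countable index\<close>

text \<open>Lift the real code \<open>V\<close> of \<open>W\<close> to \<open>V'\<close> and decode
  with the same \<open>f\<close>. Since \<open>f\<close> is strongly measurable on the whole line,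
  so is its composition with \<open>V'\<close>, wherever \<open>V'\<close> takes its values.\<close>

lemma (in prob_space) lift_strongly_measurable:
  fixes N N' :: "'a \<Rightarrow> nat" and W :: "'a \<Rightarrow> 'c::banach"
  assumes U: "U \<in> uniform_rvs M"
    and N[measurable]: "N \<in> measurable M (count_space UNIV)" "N' \<in> measurable M (count_space UNIV)"
    and W: "strongly_measurable M W"
    and law: "distr M (count_space UNIV) N' = distr M (count_space UNIV) N"
  obtains W' where "strongly_measurable M W'"
    "distr M (count_space UNIV \<Otimes>\<^sub>M borel) (\<lambda>\<omega>. (N' \<omega>, W' \<omega>)) =
     distr M (count_space UNIV \<Otimes>\<^sub>M borel) (\<lambda>\<omega>. (N \<omega>, W \<omega>))"
proof -
  obtain V :: "'a \<Rightarrow> real" and f where V[measurable]: "V \<in> borel_measurable M" and V01: "\<And>\<omega>. V \<omega> \<in> {0..1}"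
    and f: "strongly_measurable borel f" and Wf: "\<And>\<omega>. \<omega> \<in> space M \<Longrightarrow> W \<omega> = f (V \<omega>)"
    using strongly_measurable_factor_real[OF W] by blast
  obtain V' where V'[measurable]: "V' \<in> borel_measurable M"
    and V'law: "distr M (count_space UNIV \<Otimes>\<^sub>M borel) (\<lambda>\<omega>. (N' \<omega>, V' \<omega>)) =
     distr M (count_space UNIV \<Otimes>\<^sub>M borel) (\<lambda>\<omega>. (N \<omega>, V \<omega>))"
    using lift_unit_interval[OF U N V V01 law] by blast
  have [measurable]: "f \<in> borel_measurable borel"
    using f by (rule strongly_measurable_borel)
  define \<Phi> where "\<Phi> = (\<lambda>x :: nat \<times> real. (fst x, f (snd x)))"
  have [measurable]: "\<Phi> \<in> measurable (count_space UNIV \<Otimes>\<^sub>M borel) (count_space UNIV \<Otimes>\<^sub>M borel)"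
    unfolding \<Phi>_def by measurable
  let ?D = "\<lambda>X. distr M (count_space UNIV \<Otimes>\<^sub>M borel) X"
  have push: "?D (\<lambda>\<omega>. (n \<omega>, f (v \<omega>))) = distr (?D (\<lambda>\<omega>. (n \<omega>, v \<omega>))) (count_space UNIV \<Otimes>\<^sub>M borel) \<Phi>"
    if [measurable]: "n \<in> measurable M (count_space UNIV)" "v \<in> borel_measurable M" for n :: "'a \<Rightarrow> nat" and v
    by (subst distr_distr) (auto simp: o_def \<Phi>_def)
  have "?D (\<lambda>\<omega>. (N' \<omega>, f (V' \<omega>))) = ?D (\<lambda>\<omega>. (N \<omega>, f (V \<omega>)))"
    by (simp add: push V'law)
  also have "\<dots> = ?D (\<lambda>\<omega>. (N \<omega>, W \<omega>))"
    by (rule distr_cong) (auto simp: Wf)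
  finally show ?thesis
    using that[OF strongly_measurable_compose[OF f V']] by blast
qed

lemma distr_eq_compose:
  assumes "distr M N f = distr M N g" "f \<in> measurable M N" "g \<in> measurable M N" "h \<in> measurable N K"
  shows "distr M K (\<lambda>x. h (f x)) = distr M K (\<lambda>x. h (g x))"
  using arg_cong[OF assms(1), of "\<lambda>D. distr D K h"] assms(2-)
  by (simp add: distr_distr o_def)

lemma nn_integral_eq_of_distr_eq:
  assumes "distr M N f = distr M N g" "f \<in> measurable M N" "g \<in> measurable M N" "h \<in> borel_measurable N"
  shows "(\<integral>\<^sup>+x. h (f x) \<partial>M) = (\<integral>\<^sup>+x. h (g x) \<partial>M)"
  using arg_cong[OF assms(1), of "\<lambda>D. nn_integral D h"] assms(2-)
  by (simp add: nn_integral_distr)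

lemma AE_of_distr_eq:
  assumes "distr M N f = distr M N g" "f \<in> measurable M N" "g \<in> measurable M N"
    "{x\<in>space N. P x} \<in> sets N" "AE x in M. P (g x)"
  shows "AE x in M. P (f x)"
  using assms(5) AE_distr_iff[OF assms(2,4)] AE_distr_iff[OF assms(3,4)] assms(1) by metis

text \<open>Countably many balls of radius \<open>e/2\<close> cover the range of
  \<open>h (W \<omega>)\<close>. Lifting \<open>W\<close> along the index of the first ball that
  contains the value puts \<open>h (W' \<omega>)\<close> almost surely into the ball that contains
  \<open>Y' \<omega>\<close>, and the triangle inequality through the centre gives
  \<open>e\<close>.\<close>

lemma (in prob_space) lift_combination:
  fixes W :: "'a \<Rightarrow> 'c::banach" and Y' :: "'a \<Rightarrow> 'b::real_normed_vector"
  assumes U: "U \<in> uniform_rvs M" and W: "strongly_measurable M W" and Y': "strongly_measurable M Y'"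
    and h: "continuous_on UNIV h"
    and law: "distr M borel Y' = distr M borel (\<lambda>\<omega>. h (W \<omega>))" and "0 < e"
  obtains W' where "strongly_measurable M W'" "distr M borel W' = distr M borel W"
    "AE \<omega> in M. norm (Y' \<omega> - h (W' \<omega>)) \<le> e"
proof -
  define S where "S \<omega> = h (W \<omega>)" for \<omega>
  have S: "strongly_measurable M S"
    unfolding S_def by (rule strongly_measurable_continuous[OF W h])
  have [measurable]: "S \<in> borel_measurable M" "Y' \<in> borel_measurable M" "W \<in> borel_measurable M"
    using S Y' W by (auto intro: strongly_measurable_borel)
  have [measurable]: "h \<in> borel_measurable borel"
    using h by (rule borel_measurable_continuous_onI)
  obtain s where s: "\<And>i. simple_function M (s i)" "\<And>\<omega>. \<omega> \<in> space M \<Longrightarrow> (\<lambda>i. s i \<omega>) \<longlonglongrightarrow> S \<omega>"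
    using S unfolding strongly_measurable_def by blast
  \<comment> \<open>The values of the approximants form a countable set that comes arbitrarily close
    to every value of \<open>S\<close>; they serve as the centres of the balls.\<close>
  define K where "K = (\<Union>i. s i ` space M)"
  have "countable K"
    unfolding K_def using s(1) by (intro countable_UN) (auto simp: simple_function_def intro: countable_finite)
  moreover have "K \<noteq> {}"
    using not_empty by (auto simp: K_def)
  ultimately have range_k: "range (from_nat_into K) = K"
    by (simp add: range_from_nat_into)
  define k where "k = from_nat_into K"
  have near: "\<exists>j. S \<omega> \<in> ball (k j) (e/2)" if "\<omega> \<in> space M" for \<omega>
  proof -
    have "\<exists>i. dist (s i \<omega>) (S \<omega>) < e/2"
      using metric_LIMSEQ_D[OF s(2)[OF that], of "e/2"] \<open>0 < e\<close> by auto
    then obtain i where i: "dist (s i \<omega>) (S \<omega>) < e/2" ..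
    have "s i \<omega> \<in> range k" unfolding k_def range_k using that by (auto simp: K_def)
    with i show ?thesis by auto
  qed
  have ball[measurable]: "ball (k j) (e/2) \<in> sets borel" for j
    by simp
  \<comment> \<open>Off the union \<open>Near\<close> of the balls the value of
    \<open>\<kappa>\<close> carries no information; \<open>S\<close> never leaves
    \<open>Near\<close>, and by equality of laws \<open>Y'\<close> almost surely does not
    either.\<close>
  define \<kappa> where "\<kappa> x = (LEAST j. x \<in> ball (k j) (e/2))" for x
  have [measurable]: "\<kappa> \<in> measurable borel (count_space UNIV)"
    unfolding \<kappa>_def by measurable
  define Near where "Near = (\<Union>j. ball (k j) (e/2))"
  have \<kappa>: "x \<in> ball (k (\<kappa> x)) (e/2)" if "x \<in> Near" for x
    using that LeastI_ex[of "\<lambda>j. x \<in> ball (k j) (e/2)"] unfolding Near_def \<kappa>_def by blast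
  have S_near: "S \<omega> \<in> Near" if "\<omega> \<in> space M" for \<omega>
    using near[OF that] by (auto simp: Near_def)
  have law: "distr M borel Y' = distr M borel S"
    using law by (simp add: S_def[abs_def])
  have "AE \<omega> in M. Y' \<omega> \<in> Near"
  proof (rule AE_of_distr_eq[OF law])
    have "open Near" unfolding Near_def by auto
    then show "{x \<in> space borel. x \<in> Near} \<in> sets borel" by simp
  qed (use S_near in auto)
  then have 1: "AE \<omega> in M. Y' \<omega> \<in> ball (k (\<kappa> (Y' \<omega>))) (e/2)"
    by eventually_elim (rule \<kappa>)
  have Nlaw: "distr M (count_space UNIV) (\<lambda>\<omega>. \<kappa> (Y' \<omega>)) = distr M (count_space UNIV) (\<lambda>\<omega>. \<kappa> (S \<omega>))"
    by (rule distr_eq_compose[OF law]) measurable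
  have meas: "(\<lambda>\<omega>. \<kappa> (S \<omega>)) \<in> measurable M (count_space UNIV)" "(\<lambda>\<omega>. \<kappa> (Y' \<omega>)) \<in> measurable M (count_space UNIV)"
    by measurable
  obtain W' where W': "strongly_measurable M W'" and pair:
    "distr M (count_space UNIV \<Otimes>\<^sub>M borel) (\<lambda>\<omega>. (\<kappa> (Y' \<omega>), W' \<omega>)) =
     distr M (count_space UNIV \<Otimes>\<^sub>M borel) (\<lambda>\<omega>. (\<kappa> (S \<omega>), W \<omega>))"
    using lift_strongly_measurable[OF U meas W Nlaw] by blast
  have W'm[measurable]: "W' \<in> borel_measurable M"
    using W' by (rule strongly_measurable_borel)
  have W'law: "distr M borel W' = distr M borel W"
    using distr_eq_compose[OF pair, of snd borel] by simp
  have "AE \<omega> in M. h (snd (\<kappa> (Y' \<omega>), W' \<omega>)) \<in> ball (k (fst (\<kappa> (Y' \<omega>), W' \<omega>))) (e/2)"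
  proof (rule AE_of_distr_eq[OF pair])
    \<comment> \<open>Because the index is discrete, the event is a countable union of measurable
      rectangles.\<close>
    have "{x \<in> space (count_space UNIV \<Otimes>\<^sub>M borel). h (snd x) \<in> ball (k (fst x)) (e/2)}
      = (\<Union>n. {n} \<times> (h -` ball (k n) (e/2) \<inter> space borel))"
      by (auto simp: space_pair_measure)
    also have "\<dots> \<in> sets (count_space UNIV \<Otimes>\<^sub>M borel)"
      by (intro sets.countable_UN image_subsetI pair_measureI measurable_sets[of h borel borel]) auto
    finally show "{x \<in> space (count_space UNIV \<Otimes>\<^sub>M borel). h (snd x) \<in> ball (k (fst x)) (e/2)} \<in> \<dots>" .
    show "AE \<omega> in M. h (snd (\<kappa> (S \<omega>), W \<omega>)) \<in> ball (k (fst (\<kappa> (S \<omega>), W \<omega>))) (e/2)"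
      using \<kappa>[OF S_near] by (auto simp: S_def)
  qed measurable
  then have "AE \<omega> in M. h (W' \<omega>) \<in> ball (k (\<kappa> (Y' \<omega>))) (e/2)" by simp
  with 1 have "AE \<omega> in M. norm (Y' \<omega> - h (W' \<omega>)) \<le> e"
  proof eventually_elim
    case (elim \<omega>)
    then have "dist (Y' \<omega>) (h (W' \<omega>)) < e"
      using dist_triangle_half_r[of "k (\<kappa> (Y' \<omega>))" "Y' \<omega>" e "h (W' \<omega>)"] by simp
    then show ?case by (simp add: dist_norm)
  qed
  then show ?thesis using that W' W'law by blast
qed

lemma (in prob_space) lift_uniform:
  fixes N N' :: "'a \<Rightarrow> nat"
  assumes U: "U \<in> uniform_rvs M"
    and [measurable]: "N \<in> measurable M (count_space UNIV)" "N' \<in> measurable M (count_space UNIV)"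
    and law: "distr M (count_space UNIV) N' = distr M (count_space UNIV) N"
  obtains U' where "U' \<in> uniform_rvs M"
    "distr M (count_space UNIV \<Otimes>\<^sub>M borel) (\<lambda>\<omega>. (N' \<omega>, U' \<omega>)) =
     distr M (count_space UNIV \<Otimes>\<^sub>M borel) (\<lambda>\<omega>. (N \<omega>, U \<omega>))"
proof -
  have Um[measurable]: "U \<in> borel_measurable M" and U01: "\<And>\<omega>. \<omega> \<in> space M \<Longrightarrow> U \<omega> \<in> {0..1}"
    and Ucdf: "\<And>u. u \<in> {0..1} \<Longrightarrow> prob {\<omega>\<in>space M. U \<omega> \<le> u} = u"
    using U by (auto simp: uniform_rvs_def)
  obtain V where V[measurable]: "V \<in> borel_measurable M" and
    Vlaw: "distr M (count_space UNIV \<Otimes>\<^sub>M borel) (\<lambda>\<omega>. (N' \<omega>, V \<omega>)) =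
     distr M (count_space UNIV \<Otimes>\<^sub>M borel) (\<lambda>\<omega>. (N \<omega>, U \<omega>))"
    using lift_unit_interval[OF U _ _ Um U01 law] by auto
  \<comment> \<open>The lifted variable may leave the unit interval on a null set, whereas
    \<open>uniform_rvs\<close> asks for values in it everywhere. Clamping repairs this and fixes
    \<open>U\<close>, so the joint law is kept.\<close>
  define U' where "U' \<omega> = max 0 (min 1 (V \<omega>))" for \<omega>
  have [measurable]: "U' \<in> borel_measurable M"
    unfolding U'_def by measurable
  have U'01: "U' \<omega> \<in> {0..1}" for \<omega> by (simp add: U'_def)
  have "distr M (count_space UNIV \<Otimes>\<^sub>M borel) (\<lambda>\<omega>. (N' \<omega>, U' \<omega>)) =
     distr M (count_space UNIV \<Otimes>\<^sub>M borel) (\<lambda>\<omega>. (N \<omega>, max 0 (min 1 (U \<omega>))))"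
    using distr_eq_compose[OF Vlaw, of "\<lambda>x. (fst x, max 0 (min 1 (snd x)))" "count_space UNIV \<Otimes>\<^sub>M borel"]
    by (simp add: U'_def)
  also have "\<dots> = distr M (count_space UNIV \<Otimes>\<^sub>M borel) (\<lambda>\<omega>. (N \<omega>, U \<omega>))"
    by (rule distr_cong) (use U01 in auto)
  finally have pair: "distr M (count_space UNIV \<Otimes>\<^sub>M borel) (\<lambda>\<omega>. (N' \<omega>, U' \<omega>)) =
     distr M (count_space UNIV \<Otimes>\<^sub>M borel) (\<lambda>\<omega>. (N \<omega>, U \<omega>))" .
  have "distr M borel U' = distr M borel U"
    using distr_eq_compose[OF pair, of snd borel] by simp
  then have "prob {\<omega>\<in>space M. U' \<omega> \<le> u} = prob {\<omega>\<in>space M. U \<omega> \<le> u}" for u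
    using measure_distr[of U' M borel "{..u}"] measure_distr[of U M borel "{..u}"]
    by (simp add: vimage_def Int_def conj_commute)
  then have "U' \<in> uniform_rvs M"
    using U'01 by (auto simp: uniform_rvs_def Ucdf)
  then show ?thesis using that pair by blast
qed

section \<open>Expectations weighted by a function of a uniform variable\<close>

lemma nat_floor_bounds:
  assumes "0 \<le> r" "0 < e"
  shows "e * real (nat \<lfloor>r / e\<rfloor>) \<le> r" "r \<le> e * real (nat \<lfloor>r / e\<rfloor>) + e"
proof -
  have "real (nat \<lfloor>r / e\<rfloor>) = of_int \<lfloor>r / e\<rfloor>" using assms by simp
  then have "real (nat \<lfloor>r / e\<rfloor>) \<le> r / e" "r / e \<le> real (nat \<lfloor>r / e\<rfloor>) + 1"
    by linarith+
  then have "e * real (nat \<lfloor>r / e\<rfloor>) \<le> e * (r / e)" "e * (r / e) \<le> e * (real (nat \<lfloor>r / e\<rfloor>) + 1)"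
    by (intro mult_left_mono; use assms in simp)+
  then show "e * real (nat \<lfloor>r / e\<rfloor>) \<le> r" "r \<le> e * real (nat \<lfloor>r / e\<rfloor>) + e"
    using assms(2) by (simp_all add: distrib_left del: of_nat_nat)
qed

text \<open>Round \<open>R'\<close> and \<open>R\<close> down to multiples of \<open>e\<close> and
  lift \<open>U\<close> to a uniform \<open>U'\<close> that stands to the rounded \<open>R\<close>
  as \<open>U\<close> stands to the rounded \<open>R'\<close>. Rounding costs at most
  \<open>e\<close>, since the weight has expectation 1.\<close>

lemma (in prob_space) weighted_sup_law_invariant:
  fixes \<sigma> :: "real \<Rightarrow> real"
  assumes [measurable]: "\<sigma> \<in> borel_measurable borel" "R \<in> borel_measurable M" "R' \<in> borel_measurable M"
    and nonneg: "\<And>u. 0 \<le> \<sigma> u" "\<And>\<omega>. 0 \<le> R \<omega>" "\<And>\<omega>. 0 \<le> R' \<omega>"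
    and law: "distr M borel R = distr M borel R'"
    and one: "\<And>U. U \<in> uniform_rvs M \<Longrightarrow> (\<integral>\<^sup>+\<omega>. ennreal (\<sigma> (U \<omega>)) \<partial>M) = 1"
    and U: "U \<in> uniform_rvs M"
  shows "(\<integral>\<^sup>+\<omega>. ennreal (\<sigma> (U \<omega>) * R' \<omega>) \<partial>M)
    \<le> (SUP U\<in>uniform_rvs M. \<integral>\<^sup>+\<omega>. ennreal (\<sigma> (U \<omega>) * R \<omega>) \<partial>M)"
proof (rule ennreal_le_epsilon)
  fix e :: real assume e: "0 < e"
  define q where "q r = nat \<lfloor>r / e\<rfloor>" for r
  have [measurable]: "q \<in> measurable borel (count_space UNIV)"
    unfolding q_def by measurable
  have [measurable]: "U \<in> borel_measurable M" using U by (simp add: uniform_rvs_def)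
  have "distr M (count_space UNIV) (\<lambda>\<omega>. q (R \<omega>)) = distr M (count_space UNIV) (\<lambda>\<omega>. q (R' \<omega>))"
    by (rule distr_eq_compose[OF law]) measurable
  then obtain U' where U': "U' \<in> uniform_rvs M" and pair:
    "distr M (count_space UNIV \<Otimes>\<^sub>M borel) (\<lambda>\<omega>. (q (R \<omega>), U' \<omega>)) =
     distr M (count_space UNIV \<Otimes>\<^sub>M borel) (\<lambda>\<omega>. (q (R' \<omega>), U \<omega>))"
    using lift_uniform[OF U, of "\<lambda>\<omega>. q (R' \<omega>)" "\<lambda>\<omega>. q (R \<omega>)"] by auto
  have [measurable]: "U' \<in> borel_measurable M" using U' by (simp add: uniform_rvs_def)
  have q: "e * real (q r) \<le> r" "r \<le> e * real (q r) + e" if "0 \<le> r" for r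
    using nat_floor_bounds[OF that e] by (auto simp: q_def)
  have "(\<integral>\<^sup>+\<omega>. ennreal (\<sigma> (U \<omega>) * R' \<omega>) \<partial>M)
     \<le> (\<integral>\<^sup>+\<omega>. ennreal (\<sigma> (U \<omega>) * (e * real (q (R' \<omega>)))) + ennreal e * ennreal (\<sigma> (U \<omega>)) \<partial>M)"
    using e nonneg q(2)
    by (intro nn_integral_mono)
       (auto simp flip: ennreal_plus ennreal_mult intro!: ennreal_leI
             simp: mult.commute[of e "\<sigma> _"] distrib_left[symmetric] mult_left_mono)
  also have "\<dots> = (\<integral>\<^sup>+\<omega>. ennreal (\<sigma> (U \<omega>) * (e * real (q (R' \<omega>)))) \<partial>M) + ennreal e"
    by (simp add: nn_integral_add nn_integral_cmult one[OF U])
  also have "(\<integral>\<^sup>+\<omega>. ennreal (\<sigma> (U \<omega>) * (e * real (q (R' \<omega>)))) \<partial>M)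
     = (\<integral>\<^sup>+\<omega>. ennreal (\<sigma> (U' \<omega>) * (e * real (q (R \<omega>)))) \<partial>M)"
    using nn_integral_eq_of_distr_eq[OF pair, of "\<lambda>x. ennreal (\<sigma> (snd x) * (e * real (fst x)))"] by simp
  also have "\<dots> \<le> (\<integral>\<^sup>+\<omega>. ennreal (\<sigma> (U' \<omega>) * R \<omega>) \<partial>M)"
    using nonneg q(1) by (intro nn_integral_mono ennreal_leI mult_left_mono) auto
  also have "\<dots> \<le> (SUP U\<in>uniform_rvs M. \<integral>\<^sup>+\<omega>. ennreal (\<sigma> (U \<omega>) * R \<omega>) \<partial>M)"
    using U' by (rule SUP_upper)
  finally show "(\<integral>\<^sup>+\<omega>. ennreal (\<sigma> (U \<omega>) * R' \<omega>) \<partial>M)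
    \<le> (SUP U\<in>uniform_rvs M. \<integral>\<^sup>+\<omega>. ennreal (\<sigma> (U \<omega>) * R \<omega>) \<partial>M) + ennreal e"
    by simp
qed

text \<open>Here the weight is rounded instead: a lifted uniform \<open>U'\<close> makes
  \<open>\<zeta>\<close> and \<open>\<sigma> (U' \<omega>)\<close> fall into the same cell of length
  \<open>e\<close>. The resulting error \<open>e * R\<close> need not be integrable, hence the
  truncation of \<open>R\<close> at \<open>K\<close>, which is removed by monotone
  convergence.\<close>

lemma (in prob_space) nn_integral_mult_le_weighted_sup:
  fixes \<sigma> :: "real \<Rightarrow> real"
  assumes [measurable]: "\<sigma> \<in> borel_measurable borel" "R \<in> borel_measurable M" "\<zeta> \<in> borel_measurable M"
    and nonneg: "\<And>u. 0 \<le> \<sigma> u" "\<And>\<omega>. 0 \<le> R \<omega>" "\<And>\<omega>. 0 \<le> \<zeta> \<omega>"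
    and U: "U \<in> uniform_rvs M" and law: "distr M borel (\<lambda>\<omega>. \<sigma> (U \<omega>)) = distr M borel \<zeta>"
  shows "(\<integral>\<^sup>+\<omega>. ennreal (\<zeta> \<omega> * R \<omega>) \<partial>M)
    \<le> (SUP U\<in>uniform_rvs M. \<integral>\<^sup>+\<omega>. ennreal (\<sigma> (U \<omega>) * R \<omega>) \<partial>M)" (is "_ \<le> ?S")
proof -
  have trunc: "(\<integral>\<^sup>+\<omega>. ennreal (\<zeta> \<omega> * min (R \<omega>) (real K)) \<partial>M) \<le> ?S + ennreal (e * real K)" if e: "0 < e" for K :: nat and e :: real
  proof -
    define q where "q r = nat \<lfloor>r / e\<rfloor>" for r
    have [measurable]: "q \<in> measurable borel (count_space UNIV)"
      unfolding q_def by measurable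
    have [measurable]: "U \<in> borel_measurable M" using U by (simp add: uniform_rvs_def)
    have "distr M (count_space UNIV) (\<lambda>\<omega>. q (\<zeta> \<omega>)) = distr M (count_space UNIV) (\<lambda>\<omega>. q (\<sigma> (U \<omega>)))"
      by (rule distr_eq_compose[OF law[symmetric]]) measurable
    then obtain U' where U': "U' \<in> uniform_rvs M" and pair:
      "distr M (count_space UNIV \<Otimes>\<^sub>M borel) (\<lambda>\<omega>. (q (\<zeta> \<omega>), U' \<omega>)) =
       distr M (count_space UNIV \<Otimes>\<^sub>M borel) (\<lambda>\<omega>. (q (\<sigma> (U \<omega>)), U \<omega>))"
      using lift_uniform[OF U, of "\<lambda>\<omega>. q (\<sigma> (U \<omega>))" "\<lambda>\<omega>. q (\<zeta> \<omega>)"] by auto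
    have [measurable]: "U' \<in> borel_measurable M" using U' by (simp add: uniform_rvs_def)
    \<comment> \<open>The identity is trivial for the pair built from
      \<open>\<sigma> (U \<omega>)\<close> and \<open>U\<close>, and it depends only on the joint
      law.\<close>
    have "AE \<omega> in M. real (fst (q (\<zeta> \<omega>), U' \<omega>)) = real (q (\<sigma> (snd (q (\<zeta> \<omega>), U' \<omega>))))"
    proof (rule AE_of_distr_eq[OF pair])
      show "{x \<in> space (count_space UNIV \<Otimes>\<^sub>M borel). real (fst x) = real (q (\<sigma> (snd x)))}
        \<in> sets (count_space UNIV \<Otimes>\<^sub>M borel)" by measurable
    qed auto
    then have "AE \<omega> in M. \<zeta> \<omega> \<le> \<sigma> (U' \<omega>) + e"
    proof eventually_elim
      case (elim \<omega>)
      then show ?case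
        using nat_floor_bounds[OF nonneg(3) e, of \<omega>] nat_floor_bounds[OF nonneg(1) e, of "U' \<omega>"]
        by (simp add: q_def)
    qed
    then have "(\<integral>\<^sup>+\<omega>. ennreal (\<zeta> \<omega> * min (R \<omega>) (real K)) \<partial>M)
      \<le> (\<integral>\<^sup>+\<omega>. ennreal (\<sigma> (U' \<omega>) * R \<omega>) + ennreal (e * real K) \<partial>M)"
    proof (intro nn_integral_mono_AE, eventually_elim)
      case (elim \<omega>)
      have "\<zeta> \<omega> * min (R \<omega>) (real K) \<le> (\<sigma> (U' \<omega>) + e) * min (R \<omega>) (real K)"
        using elim nonneg by (intro mult_right_mono) auto
      also have "\<dots> \<le> \<sigma> (U' \<omega>) * R \<omega> + e * real K"
        unfolding distrib_right using nonneg e by (intro add_mono mult_left_mono) auto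
      finally show ?case
        using nonneg e by (simp flip: ennreal_plus add: ennreal_leI)
    qed
    also have "\<dots> = (\<integral>\<^sup>+\<omega>. ennreal (\<sigma> (U' \<omega>) * R \<omega>) \<partial>M) + ennreal (e * real K)"
      by (subst nn_integral_add) (auto simp: emeasure_space_1)
    also have "\<dots> \<le> ?S + ennreal (e * real K)"
      using U' by (intro add_right_mono SUP_upper)
    finally show ?thesis .
  qed
  \<comment> \<open>The mesh \<open>e / (K + 1)\<close> brings the truncation error
    \<open>mesh * K\<close> below \<open>e\<close>, the case \<open>K = 0\<close> included.\<close>
  have bound: "(\<integral>\<^sup>+\<omega>. ennreal (\<zeta> \<omega> * min (R \<omega>) (real K)) \<partial>M) \<le> ?S" for K
  proof (rule ennreal_le_epsilon)
    fix e :: real assume e: "0 < e"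
    have "(\<integral>\<^sup>+\<omega>. ennreal (\<zeta> \<omega> * min (R \<omega>) (real K)) \<partial>M) \<le> ?S + ennreal (e / (real K + 1) * real K)"
      using e by (intro trunc) auto
    also have "\<dots> \<le> ?S + ennreal e"
      using e by (intro add_left_mono ennreal_leI) (auto simp: field_simps)
    finally show "(\<integral>\<^sup>+\<omega>. ennreal (\<zeta> \<omega> * min (R \<omega>) (real K)) \<partial>M) \<le> ?S + ennreal e" .
  qed
  have sup: "(SUP K. ennreal (\<zeta> \<omega> * min (R \<omega>) (real K))) = ennreal (\<zeta> \<omega> * R \<omega>)" for \<omega>
  proof (rule antisym)
    obtain K :: nat where "R \<omega> \<le> real K" using real_arch_simple by blast
    then show "ennreal (\<zeta> \<omega> * R \<omega>) \<le> (SUP K. ennreal (\<zeta> \<omega> * min (R \<omega>) (real K)))"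
      by (intro SUP_upper2[of K]) auto
  qed (use nonneg in \<open>auto intro!: SUP_least ennreal_leI mult_left_mono\<close>)
  have "(\<integral>\<^sup>+\<omega>. ennreal (\<zeta> \<omega> * R \<omega>) \<partial>M) = (SUP K. \<integral>\<^sup>+\<omega>. ennreal (\<zeta> \<omega> * min (R \<omega>) (real K)) \<partial>M)"
    unfolding sup[symmetric]
    by (intro nn_integral_monotone_convergence_SUP)
       (use nonneg in \<open>auto simp: incseq_def le_fun_def intro!: ennreal_leI mult_left_mono\<close>)
  also have "\<dots> \<le> ?S" using bound by (intro SUP_least) auto
  finally show ?thesis .
qed

section \<open>Jensen's inequality for a weighted probability\<close>

text \<open>This is the tangent to the convex power function at \<open>c\<close>, rearranged to
  avoid subtraction. It comes from Young's inequality with conjugate exponent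
  \<open>p / (p - 1)\<close>, so \<open>p = 1\<close> is treated separately.\<close>

lemma powr_tangent_line:
  fixes x c p :: real
  assumes "0 \<le> x" "0 < c" "1 \<le> p"
  shows "p * c powr (p - 1) * x \<le> x powr p + (p - 1) * c powr p"
proof (cases "p = 1")
  case False
  then have p: "p > 1" using assms by simp
  have "x * c powr (p - 1) \<le> x powr p / p + (c powr (p - 1)) powr (p / (p - 1)) / (p / (p - 1))"
    by (rule Youngs_inequality) (use p assms in \<open>auto simp: field_simps\<close>)
  also have "(c powr (p - 1)) powr (p / (p - 1)) = c powr p"
    using p by (simp add: powr_powr)
  finally have "p * (x * c powr (p - 1)) \<le> p * (x powr p / p + c powr p / (p / (p - 1)))"
    using p by (intro mult_left_mono) auto
  also have "\<dots> = x powr p + (p - 1) * c powr p"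
    using p by (simp add: distrib_left)
  finally show ?thesis by (simp add: mult_ac)
qed (use assms in simp)

text \<open>Integrate the tangent inequality at \<open>c\<close> against the probability with
  density \<open>w\<close>, then cancel the slope \<open>d\<close>. Strict positivity of
  \<open>c\<close> makes the slope positive.\<close>

lemma (in prob_space) weighted_jensen:
  assumes [measurable]: "w \<in> borel_measurable M" "R \<in> borel_measurable M"
    and nonneg: "\<And>\<omega>. 0 \<le> w \<omega>" "\<And>\<omega>. 0 \<le> R \<omega>"
    and one: "(\<integral>\<^sup>+\<omega>. ennreal (w \<omega>) \<partial>M) = 1" and c: "0 < c" and p: "1 \<le> p"
    and le: "(\<integral>\<^sup>+\<omega>. ennreal (w \<omega> * R \<omega> powr p) \<partial>M) \<le> ennreal (c powr p)"
  shows "(\<integral>\<^sup>+\<omega>. ennreal (w \<omega> * R \<omega>) \<partial>M) \<le> ennreal c"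
proof -
  define d where "d = p * c powr (p - 1)"
  have d: "0 < d" using c p by (simp add: d_def)
  have "ennreal d * (\<integral>\<^sup>+\<omega>. ennreal (w \<omega> * R \<omega>) \<partial>M) = (\<integral>\<^sup>+\<omega>. ennreal (d * (w \<omega> * R \<omega>)) \<partial>M)"
    using d nonneg by (simp add: nn_integral_cmult[symmetric] ennreal_mult)
  also have "\<dots> \<le> (\<integral>\<^sup>+\<omega>. ennreal (w \<omega> * R \<omega> powr p) + ennreal ((p - 1) * c powr p) * ennreal (w \<omega>) \<partial>M)"
  proof (rule nn_integral_mono)
    fix \<omega>
    have "d * (w \<omega> * R \<omega>) = w \<omega> * (p * c powr (p - 1) * R \<omega>)" by (simp add: d_def)
    also have "\<dots> \<le> w \<omega> * (R \<omega> powr p + (p - 1) * c powr p)"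
      using powr_tangent_line[OF nonneg(2) c p] nonneg(1) by (rule mult_left_mono)
    also have "\<dots> = w \<omega> * R \<omega> powr p + (p - 1) * c powr p * w \<omega>" by (simp add: algebra_simps)
    finally have "ennreal (d * (w \<omega> * R \<omega>)) \<le> ennreal (w \<omega> * R \<omega> powr p + (p - 1) * c powr p * w \<omega>)"
      by (rule ennreal_leI)
    then show "ennreal (d * (w \<omega> * R \<omega>)) \<le> ennreal (w \<omega> * R \<omega> powr p) + ennreal ((p - 1) * c powr p) * ennreal (w \<omega>)"
      using nonneg p by (simp add: ennreal_plus ennreal_mult)
  qed
  also have "\<dots> = (\<integral>\<^sup>+\<omega>. ennreal (w \<omega> * R \<omega> powr p) \<partial>M) + ennreal ((p - 1) * c powr p)"
    by (simp add: nn_integral_add nn_integral_cmult one)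
  also have "\<dots> \<le> ennreal (c powr p) + ennreal ((p - 1) * c powr p)"
    using le by (rule add_right_mono)
  also have "\<dots> = ennreal (p * c powr p)"
  proof -
    have "c powr p + (p - 1) * c powr p = p * c powr p" by (simp add: left_diff_distrib)
    then show ?thesis
      using ennreal_plus[of "c powr p" "(p - 1) * c powr p"] p by simp
  qed
  also have "\<dots> = ennreal d * ennreal c"
    using c p by (simp add: d_def ennreal_mult[symmetric] powr_diff)
  finally show ?thesis
    using d by (simp add: ennreal_mult_le_mult_iff)
qed

section \<open>The distortion function of Z and its norm\<close>

text \<open>Everything rests on the Galois connection between a distribution function and its
  pseudo-inverse, valid for levels strictly between 0 and 1. A uniform variable misses both end
  points almost surely, so \<open>sigma_of M Z (U \<omega>) \<le> q\<close> has the probability of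
  \<open>U \<omega> \<le> F.C q\<close>.\<close>

lemma (in prob_space) sigma_of_properties:
  fixes Z :: "'a \<Rightarrow> 'b::real_normed_vector"
  assumes Z: "strongly_measurable M Z"
  shows sigma_of_nonneg: "0 \<le> sigma_of M Z u"
    and sigma_of_borel: "sigma_of M Z \<in> borel_measurable borel"
    and sigma_of_uniform_law: "U \<in> uniform_rvs M \<Longrightarrow>
      distr M borel (\<lambda>\<omega>. sigma_of M Z (U \<omega>)) = distr M borel (\<lambda>\<omega>. norm (Z \<omega>))"
proof -
  have [measurable]: "(\<lambda>\<omega>. norm (Z \<omega>)) \<in> borel_measurable M"
    by (intro strongly_measurable_borel strongly_measurable_continuous[OF Z] continuous_intros)
  interpret F: cdf_distribution "distr M borel (\<lambda>\<omega>. norm (Z \<omega>))"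
    unfolding cdf_distribution_def by simp
  have \<sigma>: "sigma_of M Z u = (if 0 < u \<and> u < 1 then F.I u else 0)" for u
    by (simp add: sigma_of_def quantile_def)
  show "0 \<le> sigma_of M Z u"
  proof (cases "0 < u \<and> u < 1")
    case True
    show ?thesis
    proof (rule ccontr)
      \<comment> \<open>A negative quantile at level \<open>u\<close> would leave mass at least
        \<open>u > 0\<close> on negative values of a norm.\<close>
      assume "\<not> 0 \<le> sigma_of M Z u"
      then have neg: "F.I u < 0" using True by (simp add: \<sigma>)
      have "u \<le> F.C (F.I u)"
        using F.pseudoinverse'[rule_format, of u "F.I u"] True by simp
      also have "F.C (F.I u) = measure M {\<omega>\<in>space M. norm (Z \<omega>) \<le> F.I u}"
        by (simp add: cdf_def measure_distr vimage_def Int_def conj_commute)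
      also have "{\<omega>\<in>space M. norm (Z \<omega>) \<le> F.I u} = {}"
        using neg by (auto simp: not_le intro: less_le_trans)
      finally show False using True by simp
    qed
  qed (auto simp: \<sigma>)
  show borel[measurable]: "sigma_of M Z \<in> borel_measurable borel"
    using F.measurable_CI unfolding \<sigma>[abs_def]
    by (subst (asm) measurable_restrict_space_iff[where c=0]) (auto simp: greaterThanLessThan_def greaterThan_def lessThan_def Int_def cong: if_cong)
  show "distr M borel (\<lambda>\<omega>. sigma_of M Z (U \<omega>)) = distr M borel (\<lambda>\<omega>. norm (Z \<omega>))"
    if U: "U \<in> uniform_rvs M"
  proof (rule cdf_unique)
    have [measurable]: "U \<in> borel_measurable M" and U01: "\<And>\<omega>. \<omega> \<in> space M \<Longrightarrow> U \<omega> \<in> {0..1}"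
      and Ucdf: "\<And>u. u \<in> {0..1} \<Longrightarrow> prob {\<omega>\<in>space M. U \<omega> \<le> u} = u"
      using U by (auto simp: uniform_rvs_def)
    show "real_distribution (distr M borel (\<lambda>\<omega>. sigma_of M Z (U \<omega>)))" by simp
    show "real_distribution (distr M borel (\<lambda>\<omega>. norm (Z \<omega>)))" by simp
    have ne: "AE \<omega> in M. U \<omega> \<noteq> x" for x
      using uniform_rvs_atomless[OF U, of x]
      by (subst AE_iff_measurable[OF _ refl]) (auto simp: emeasure_eq_measure)
    show "cdf (distr M borel (\<lambda>\<omega>. sigma_of M Z (U \<omega>))) = F.C"
    proof
      fix q
      have "cdf (distr M borel (\<lambda>\<omega>. sigma_of M Z (U \<omega>))) q = prob {\<omega>\<in>space M. sigma_of M Z (U \<omega>) \<le> q}"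
        by (simp add: cdf_def measure_distr vimage_def Int_def conj_commute)
      also have "\<dots> = prob {\<omega>\<in>space M. U \<omega> \<le> F.C q}"
      proof (rule finite_measure_eq_AE)
        show "AE \<omega> in M. \<omega> \<in> {\<omega>\<in>space M. sigma_of M Z (U \<omega>) \<le> q} \<longleftrightarrow> \<omega> \<in> {\<omega>\<in>space M. U \<omega> \<le> F.C q}"
          using ne[of 0] ne[of 1] AE_space
        proof eventually_elim
          case (elim \<omega>)
          then have "0 < U \<omega>" "U \<omega> < 1" using U01[of \<omega>] by auto
          then show ?case
            using F.pseudoinverse'[rule_format, of "U \<omega>" q] by (simp add: \<sigma>)
        qed
      qed measurable
      also have "\<dots> = F.C q"
        using F.cdf_nonneg F.cdf_bounded_prob by (intro Ucdf) auto
      finally show "cdf (distr M borel (\<lambda>\<omega>. sigma_of M Z (U \<omega>))) q = F.C q" .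
    qed
  qed
qed

lemma sigma_norm_finite_iff: "sigma_norm M \<sigma> p Y < \<top> \<longleftrightarrow> sigma_norm_pow M \<sigma> p Y < \<top>"
  by (auto simp: sigma_norm_def less_top)

text \<open>Three comparisons in a row: the norm of \<open>Z\<close> is replaced by its quantile
  function at a uniform variable, then \<open>Y'\<close> by \<open>Y\<close> through law invariance,
  and finally the first power by the \<open>p\<close>-th through Jensen's inequality.\<close>

lemma (in prob_space) nn_integral_norm_mult_le_sigma_norm:
  fixes Z :: "'a \<Rightarrow> 'c::real_normed_vector" and Y Y' :: "'a \<Rightarrow> 'b::real_normed_vector"
  assumes Z: "strongly_measurable M Z" and one: "(\<integral>\<omega>. norm (Z \<omega>) \<partial>M) = 1" and U: "U \<in> uniform_rvs M"
    and p: "1 \<le> p" and Y: "strongly_measurable M Y" "strongly_measurable M Y'"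
    and law: "distr M borel Y' = distr M borel Y"
  shows "(\<integral>\<^sup>+\<omega>. ennreal (norm (Z \<omega>) * norm (Y' \<omega>)) \<partial>M) \<le> sigma_norm M (sigma_of M Z) p Y"
proof -
  let ?\<sigma> = "sigma_of M Z"
  have Zm[measurable]: "(\<lambda>\<omega>. norm (Z \<omega>)) \<in> borel_measurable M"
    by (intro strongly_measurable_borel strongly_measurable_continuous[OF Z] continuous_intros)
  have [measurable]: "Y \<in> borel_measurable M" "Y' \<in> borel_measurable M"
    using Y by (auto intro: strongly_measurable_borel)
  have [measurable]: "(\<lambda>y::'b. norm y) \<in> borel_measurable borel"
    by (intro borel_measurable_continuous_onI continuous_intros)
  note [measurable] = sigma_of_borel[OF Z]
  have nlaw: "distr M borel (\<lambda>\<omega>. norm (Y \<omega>)) = distr M borel (\<lambda>\<omega>. norm (Y' \<omega>))"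
    by (rule distr_eq_compose[OF law[symmetric]]) measurable
  \<comment> \<open>A function that is not integrable has integral 0 by convention, so the value 1
    already certifies integrability.\<close>
  have "integrable M (\<lambda>\<omega>. norm (Z \<omega>))"
    using one not_integrable_integral_eq by fastforce
  then have "(\<integral>\<^sup>+\<omega>. ennreal (norm (Z \<omega>)) \<partial>M) = 1"
    by (subst nn_integral_eq_integral) (auto simp: one)
  then have \<sigma>one: "(\<integral>\<^sup>+\<omega>. ennreal (?\<sigma> (V \<omega>)) \<partial>M) = 1" if V: "V \<in> uniform_rvs M" for V
  proof -
    have [measurable]: "V \<in> borel_measurable M" using V by (simp add: uniform_rvs_def)
    show ?thesis
      using nn_integral_eq_of_distr_eq[OF sigma_of_uniform_law[OF Z V], of ennreal]
        \<open>(\<integral>\<^sup>+\<omega>. ennreal (norm (Z \<omega>)) \<partial>M) = 1\<close> by simp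
  qed
  have "(\<integral>\<^sup>+\<omega>. ennreal (norm (Z \<omega>) * norm (Y' \<omega>)) \<partial>M)
      \<le> (SUP V\<in>uniform_rvs M. \<integral>\<^sup>+\<omega>. ennreal (?\<sigma> (V \<omega>) * norm (Y' \<omega>)) \<partial>M)"
    by (rule nn_integral_mult_le_weighted_sup[OF _ _ _ sigma_of_nonneg[OF Z] _ _ U sigma_of_uniform_law[OF Z U]])
       (auto intro: sigma_of_borel[OF Z])
  also have "\<dots> \<le> (SUP V\<in>uniform_rvs M. \<integral>\<^sup>+\<omega>. ennreal (?\<sigma> (V \<omega>) * norm (Y \<omega>)) \<partial>M)"
    by (rule SUP_least, rule weighted_sup_law_invariant[OF _ _ _ sigma_of_nonneg[OF Z] _ _ nlaw \<sigma>one])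
       (auto intro: sigma_of_borel[OF Z])
  also have "\<dots> \<le> sigma_norm M ?\<sigma> p Y"
  proof (rule SUP_least)
    fix V assume V: "V \<in> uniform_rvs M"
    then have [measurable]: "V \<in> borel_measurable M" by (simp add: uniform_rvs_def)
    show "(\<integral>\<^sup>+\<omega>. ennreal (?\<sigma> (V \<omega>) * norm (Y \<omega>)) \<partial>M) \<le> sigma_norm M ?\<sigma> p Y"
    proof (cases "sigma_norm_pow M ?\<sigma> p Y = \<infinity>")
      case False
      define a where "a = enn2real (sigma_norm_pow M ?\<sigma> p Y)"
      have a: "sigma_norm_pow M ?\<sigma> p Y = ennreal a" "0 \<le> a"
        using False by (auto simp: a_def less_top)
      have norm_eq: "sigma_norm M ?\<sigma> p Y = ennreal (a powr (1/p))"
        using False by (simp add: sigma_norm_def a_def)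
      show ?thesis
        unfolding norm_eq
      proof (rule ennreal_le_epsilon)
        fix e :: real assume e: "0 < e"
        \<comment> \<open>The norm itself may be 0, but Jensen's inequality is applied at a strictly
          positive point; \<open>e\<close> is then arbitrary.\<close>
        let ?c = "a powr (1/p) + e"
        have "(\<integral>\<^sup>+\<omega>. ennreal (?\<sigma> (V \<omega>) * norm (Y \<omega>)) \<partial>M) \<le> ennreal ?c"
        proof (rule weighted_jensen[OF _ _ _ _ \<sigma>one[OF V] _ p])
          have "(\<integral>\<^sup>+\<omega>. ennreal (?\<sigma> (V \<omega>) * norm (Y \<omega>) powr p) \<partial>M) \<le> ennreal a"
            unfolding a(1)[symmetric] sigma_norm_pow_def using V by (rule SUP_upper)
          also have "a = (a powr (1/p)) powr p" using p a(2) by (simp add: powr_powr)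
          also have "\<dots> \<le> ?c powr p" using p e by (intro powr_mono2) auto
          finally show "(\<integral>\<^sup>+\<omega>. ennreal (?\<sigma> (V \<omega>) * norm (Y \<omega>) powr p) \<partial>M) \<le> ennreal (?c powr p)"
            by (simp add: ennreal_leI)
          show "0 < ?c" using e by (simp add: add_nonneg_pos)
        qed (auto simp: sigma_of_nonneg[OF Z])
        also have "\<dots> = ennreal (a powr (1/p)) + ennreal e"
          using e by (simp add: ennreal_plus)
        finally show "(\<integral>\<^sup>+\<omega>. ennreal (?\<sigma> (V \<omega>) * norm (Y \<omega>)) \<partial>M) \<le> ennreal (a powr (1/p)) + ennreal e" .
      qed
    qed (simp add: sigma_norm_def)
  qed
  finally show ?thesis .
qed

lemma powr_add_le:
  fixes x y p :: real
  assumes "0 \<le> x" "0 \<le> y" "0 \<le> p"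
  shows "(x + y) powr p \<le> 2 powr p * (x powr p + y powr p)"
proof -
  have "(x + y) powr p \<le> (2 * max x y) powr p"
    using assms by (intro powr_mono2) auto
  also have "\<dots> = 2 powr p * max x y powr p"
    using assms by (simp add: powr_mult)
  also have "\<dots> \<le> 2 powr p * (x powr p + y powr p)"
    by (intro mult_left_mono) (auto simp: max_def)
  finally show ?thesis .
qed

text \<open>Only finiteness is at stake, so the crude constant \<open>2 powr p\<close> does the work
  of Minkowski's inequality.\<close>

lemma L_sigma_add_scaleR:
  fixes Y1 Y2 :: "'a \<Rightarrow> 'b::real_normed_vector"
  assumes Y: "Y1 \<in> L_sigma M \<sigma> p" "Y2 \<in> L_sigma M \<sigma> p" and p: "1 \<le> p"
    and \<sigma>: "\<And>u. 0 \<le> \<sigma> u" and [measurable]: "\<sigma> \<in> borel_measurable borel"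
  shows "(\<lambda>\<omega>. a *\<^sub>R Y1 \<omega> + b *\<^sub>R Y2 \<omega>) \<in> L_sigma M \<sigma> p"
proof -
  have Ys: "strongly_measurable M Y1" "strongly_measurable M Y2"
    and fin: "sigma_norm_pow M \<sigma> p Y1 < \<infinity>" "sigma_norm_pow M \<sigma> p Y2 < \<infinity>"
    using Y by (auto simp: L_sigma_def sigma_norm_finite_iff)
  have [measurable]: "(\<lambda>\<omega>. norm (Y1 \<omega>)) \<in> borel_measurable M" "(\<lambda>\<omega>. norm (Y2 \<omega>)) \<in> borel_measurable M"
    by (intro strongly_measurable_borel strongly_measurable_continuous[OF Ys(1)]
        strongly_measurable_continuous[OF Ys(2)] continuous_intros)+
  define A where "A = 2 powr p * \<bar>a\<bar> powr p"
  define B where "B = 2 powr p * \<bar>b\<bar> powr p"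
  have nn: "0 \<le> A" "0 \<le> B" by (auto simp: A_def B_def)
  have "sigma_norm_pow M \<sigma> p (\<lambda>\<omega>. a *\<^sub>R Y1 \<omega> + b *\<^sub>R Y2 \<omega>)
     \<le> ennreal A * sigma_norm_pow M \<sigma> p Y1 + ennreal B * sigma_norm_pow M \<sigma> p Y2"
    unfolding sigma_norm_pow_def[of _ _ _ "\<lambda>\<omega>. a *\<^sub>R Y1 \<omega> + b *\<^sub>R Y2 \<omega>"]
  proof (rule SUP_least)
    fix U assume U: "U \<in> uniform_rvs M"
    then have [measurable]: "U \<in> borel_measurable M" by (simp add: uniform_rvs_def)
    have "(\<integral>\<^sup>+\<omega>. ennreal (\<sigma> (U \<omega>) * norm (a *\<^sub>R Y1 \<omega> + b *\<^sub>R Y2 \<omega>) powr p) \<partial>M)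
      \<le> (\<integral>\<^sup>+\<omega>. ennreal A * ennreal (\<sigma> (U \<omega>) * norm (Y1 \<omega>) powr p)
             + ennreal B * ennreal (\<sigma> (U \<omega>) * norm (Y2 \<omega>) powr p) \<partial>M)"
    proof (rule nn_integral_mono)
      fix \<omega>
      have "norm (a *\<^sub>R Y1 \<omega> + b *\<^sub>R Y2 \<omega>) powr p \<le> (\<bar>a\<bar> * norm (Y1 \<omega>) + \<bar>b\<bar> * norm (Y2 \<omega>)) powr p"
        using p by (intro powr_mono2) (auto intro: norm_triangle_le)
      also have "\<dots> \<le> 2 powr p * ((\<bar>a\<bar> * norm (Y1 \<omega>)) powr p + (\<bar>b\<bar> * norm (Y2 \<omega>)) powr p)"
        using p by (intro powr_add_le) auto
      also have "\<dots> = A * norm (Y1 \<omega>) powr p + B * norm (Y2 \<omega>) powr p"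
        by (simp add: A_def B_def powr_mult algebra_simps)
      finally have "\<sigma> (U \<omega>) * norm (a *\<^sub>R Y1 \<omega> + b *\<^sub>R Y2 \<omega>) powr p
         \<le> \<sigma> (U \<omega>) * (A * norm (Y1 \<omega>) powr p + B * norm (Y2 \<omega>) powr p)"
        using \<sigma> by (intro mult_left_mono) auto
      also have "\<dots> = A * (\<sigma> (U \<omega>) * norm (Y1 \<omega>) powr p) + B * (\<sigma> (U \<omega>) * norm (Y2 \<omega>) powr p)"
        by (simp add: algebra_simps)
      finally show "ennreal (\<sigma> (U \<omega>) * norm (a *\<^sub>R Y1 \<omega> + b *\<^sub>R Y2 \<omega>) powr p)
        \<le> ennreal A * ennreal (\<sigma> (U \<omega>) * norm (Y1 \<omega>) powr p) + ennreal B * ennreal (\<sigma> (U \<omega>) * norm (Y2 \<omega>) powr p)"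
        using nn \<sigma> by (simp flip: ennreal_mult ennreal_plus add: ennreal_leI)
    qed
    also have "\<dots> = ennreal A * (\<integral>\<^sup>+\<omega>. ennreal (\<sigma> (U \<omega>) * norm (Y1 \<omega>) powr p) \<partial>M)
       + ennreal B * (\<integral>\<^sup>+\<omega>. ennreal (\<sigma> (U \<omega>) * norm (Y2 \<omega>) powr p) \<partial>M)"
      by (simp add: nn_integral_add nn_integral_cmult)
    also have "\<dots> \<le> ennreal A * sigma_norm_pow M \<sigma> p Y1 + ennreal B * sigma_norm_pow M \<sigma> p Y2"
      unfolding sigma_norm_pow_def using U by (intro add_mono mult_left_mono SUP_upper) auto
    finally show "(\<integral>\<^sup>+\<omega>. ennreal (\<sigma> (U \<omega>) * norm (a *\<^sub>R Y1 \<omega> + b *\<^sub>R Y2 \<omega>) powr p) \<partial>M) \<le> \<dots>" .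
  qed
  also have "\<dots> < \<infinity>"
    using fin by (simp add: ennreal_mult_less_top)
  finally show ?thesis
    using strongly_measurable_add_scaleR[OF Ys] by (simp add: L_sigma_def sigma_norm_finite_iff)
qed

section \<open>The functional given by the supremum over a law class\<close>

theorem proposition7:
  fixes M :: "'w measure"
    and Z :: "'w \<Rightarrow> ('b::banach \<Rightarrow>\<^sub>L real)"
    and p :: real
    and L :: "('w \<Rightarrow> 'b) set"
  assumes "prob_space M"
    and "uniform_rvs M \<noteq> {}"
    and "bochner_integrable M Z"
    and "(\<integral>\<omega>. norm (Z \<omega>) \<partial>M) = 1"
    and "1 \<le> p"
  defines "L \<equiv> L_sigma M (sigma_of M Z) p"
  shows
    "(\<forall>Y\<in>L.
        (\<forall>Y'\<in>same_law_class M Y. integrable M (\<lambda>\<omega>. blinfun_apply (Z \<omega>) (Y' \<omega>)))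
        \<and> rho_values M Z Y \<noteq> {} \<and> bdd_above (rho_values M Z Y))
     \<and> (\<forall>Y1\<in>L. \<forall>Y2\<in>L. (AE \<omega> in M. Y1 \<omega> = Y2 \<omega>) \<longrightarrow> rho M Z Y1 = rho M Z Y2)
     \<and> (\<forall>Y1\<in>L. \<forall>Y2\<in>L.
          (\<lambda>\<omega>. Y1 \<omega> + Y2 \<omega>) \<in> L
          \<and> rho M Z (\<lambda>\<omega>. Y1 \<omega> + Y2 \<omega>) \<le> rho M Z Y1 + rho M Z Y2)
     \<and> (\<forall>Y1\<in>L. \<forall>Y2\<in>L. \<forall>t\<in>{0..1::real}.
          (\<lambda>\<omega>. (1 - t) *\<^sub>R Y1 \<omega> + t *\<^sub>R Y2 \<omega>) \<in> L
          \<and> rho M Z (\<lambda>\<omega>. (1 - t) *\<^sub>R Y1 \<omega> + t *\<^sub>R Y2 \<omega>)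
              \<le> (1 - t) * rho M Z Y1 + t * rho M Z Y2)
     \<and> (\<forall>Y1\<in>L. \<forall>Y2\<in>L.
          ennreal \<bar>rho M Z Y1 - rho M Z Y2\<bar>
            \<le> sigma_norm M (sigma_of M Z) p (\<lambda>\<omega>. Y1 \<omega> - Y2 \<omega>))"
proof -
  interpret prob_space M by fact
  obtain U where U: "U \<in> uniform_rvs M" using assms(2) by blast
  have Z: "strongly_measurable M Z"
    using assms(3) by (simp add: bochner_integrable_def)
  note one = assms(4) and p = assms(5)
  let ?\<sigma> = "sigma_of M Z"
  have Zint: "integrable M (\<lambda>\<omega>. norm (Z \<omega>))"
    using one not_integrable_integral_eq by fastforce
  have LY: "strongly_measurable M Y" "sigma_norm M ?\<sigma> p Y < \<infinity>" if "Y \<in> L" for Y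
    using that by (auto simp: L_def L_sigma_def)
  have comb_L: "(\<lambda>\<omega>. a *\<^sub>R Y1 \<omega> + b *\<^sub>R Y2 \<omega>) \<in> L" if "Y1 \<in> L" "Y2 \<in> L" for Y1 Y2 a b
    using that L_sigma_add_scaleR[OF _ _ p sigma_of_nonneg[OF Z] sigma_of_borel[OF Z]] by (simp add: L_def)
  \<comment> \<open>Evaluation of a functional at a vector is jointly continuous, so the pairing of
    two strongly measurable functions is again one.\<close>
  have pairing: "(\<lambda>\<omega>. Z \<omega> (Y \<omega>)) \<in> borel_measurable M" if "strongly_measurable M Y" for Y
    by (intro strongly_measurable_borel strongly_measurable_continuous2[OF Z that] continuous_intros)
  have abs_bound: "\<bar>Z \<omega> (Y \<omega>)\<bar> \<le> norm (Z \<omega>) * norm (Y \<omega>)" for Y and \<omega>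
    using norm_blinfun[of "Z \<omega>" "Y \<omega>"] by simp
  \<comment> \<open>The bound involves the norm of \<open>Y\<close>, not of \<open>Y'\<close>, and
    is therefore uniform over the law class; it gives integrability and finiteness of the supremum
    at once.\<close>
  have bound: "integrable M (\<lambda>\<omega>. Z \<omega> (Y' \<omega>))"
    "ennreal (\<integral>\<omega>. Z \<omega> (Y' \<omega>) \<partial>M) \<le> sigma_norm M ?\<sigma> p Y"
    if Y: "Y \<in> L" and Y': "Y' \<in> same_law_class M Y" for Y Y'
  proof -
    have Y's: "strongly_measurable M Y'" and law: "distr M borel Y' = distr M borel Y"
      using Y' by (auto simp: same_law_class_def)
    have le: "(\<integral>\<^sup>+\<omega>. ennreal \<bar>Z \<omega> (Y' \<omega>)\<bar> \<partial>M) \<le> sigma_norm M ?\<sigma> p Y"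
    proof -
      have "(\<integral>\<^sup>+\<omega>. ennreal \<bar>Z \<omega> (Y' \<omega>)\<bar> \<partial>M) \<le> (\<integral>\<^sup>+\<omega>. ennreal (norm (Z \<omega>) * norm (Y' \<omega>)) \<partial>M)"
        by (intro nn_integral_mono ennreal_leI abs_bound)
      also have "\<dots> \<le> sigma_norm M ?\<sigma> p Y"
        by (rule nn_integral_norm_mult_le_sigma_norm[OF Z one U p LY(1)[OF Y] Y's law])
      finally show ?thesis .
    qed
    show int: "integrable M (\<lambda>\<omega>. Z \<omega> (Y' \<omega>))"
      unfolding integrable_iff_bounded
      using pairing[OF Y's] le_less_trans[OF le LY(2)[OF Y]] by simp
    have "ennreal (\<integral>\<omega>. Z \<omega> (Y' \<omega>) \<partial>M) \<le> ennreal (\<integral>\<omega>. \<bar>Z \<omega> (Y' \<omega>)\<bar> \<partial>M)"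
      using int by (intro ennreal_leI integral_mono) auto
    also have "\<dots> = (\<integral>\<^sup>+\<omega>. ennreal \<bar>Z \<omega> (Y' \<omega>)\<bar> \<partial>M)"
      using int by (subst nn_integral_eq_integral) auto
    finally show "ennreal (\<integral>\<omega>. Z \<omega> (Y' \<omega>) \<partial>M) \<le> sigma_norm M ?\<sigma> p Y"
      using le by (rule order_trans)
  qed
  have ne: "rho_values M Z Y \<noteq> {}" if "Y \<in> L" for Y
    using LY(1)[OF that] by (auto simp: rho_values_def same_law_class_def)
  have ub: "x \<le> enn2real (sigma_norm M ?\<sigma> p Y)" if "Y \<in> L" "x \<in> rho_values M Z Y" for Y x
  proof -
    have "ennreal x \<le> ennreal (enn2real (sigma_norm M ?\<sigma> p Y))"
      using bound(2)[OF that(1)] that LY(2)[OF that(1)] by (auto simp: rho_values_def)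
    then show ?thesis by (simp add: ennreal_le_iff)
  qed
  have bdd: "bdd_above (rho_values M Z Y)" if "Y \<in> L" for Y
    using ub[OF that] by (rule bdd_aboveI)
  have rho_upper: "(\<integral>\<omega>. Z \<omega> (Y' \<omega>) \<partial>M) \<le> rho M Z Y" if "Y \<in> L" "Y' \<in> same_law_class M Y" for Y Y'
    unfolding rho_def using that by (intro cSup_upper bdd) (auto simp: rho_values_def)
  have rho_le: "rho M Z Y \<le> enn2real (sigma_norm M ?\<sigma> p Y)" if "Y \<in> L" for Y
    unfolding rho_def using ne[OF that] ub[OF that] by (rule cSup_least)
  \<comment> \<open>Coefficients 1 and 1 will give subadditivity, \<open>1 - t\<close> and
    \<open>t\<close> convexity.\<close>
  have rho_comb: "rho M Z (\<lambda>\<omega>. a *\<^sub>R Y1 \<omega> + b *\<^sub>R Y2 \<omega>) \<le> a * rho M Z Y1 + b * rho M Z Y2"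
    if Y: "Y1 \<in> L" "Y2 \<in> L" and ab: "0 \<le> a" "0 \<le> b" for Y1 Y2 a b
    unfolding rho_def[of _ _ "\<lambda>\<omega>. a *\<^sub>R Y1 \<omega> + b *\<^sub>R Y2 \<omega>"]
  proof (rule cSup_least[OF ne[OF comb_L[OF Y]]], rule field_le_epsilon)
    fix x and e :: real
    assume x: "x \<in> rho_values M Z (\<lambda>\<omega>. a *\<^sub>R Y1 \<omega> + b *\<^sub>R Y2 \<omega>)" and e: "0 < e"
    obtain Y' where Y': "Y' \<in> same_law_class M (\<lambda>\<omega>. a *\<^sub>R Y1 \<omega> + b *\<^sub>R Y2 \<omega>)"
      and x_eq: "x = (\<integral>\<omega>. Z \<omega> (Y' \<omega>) \<partial>M)"
      using x by (auto simp: rho_values_def)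
    have Y's: "strongly_measurable M Y'"
      and law: "distr M borel Y' = distr M borel (\<lambda>\<omega>. a *\<^sub>R Y1 \<omega> + b *\<^sub>R Y2 \<omega>)"
      using Y' by (auto simp: same_law_class_def)
    define h where "h = (\<lambda>w :: 'b \<times> 'b. a *\<^sub>R fst w + b *\<^sub>R snd w)"
    have h: "continuous_on UNIV h"
      unfolding h_def by (intro continuous_intros)
    \<comment> \<open>\<open>Y1\<close> and \<open>Y2\<close> are lifted together as one
      product-valued function; the components of the lift \<open>W'\<close> then have the laws of
      \<open>Y1\<close> and \<open>Y2\<close>, and \<open>h\<close> recombines them to within
      \<open>e\<close> of \<open>Y'\<close>.\<close>
    have Ws: "strongly_measurable M (\<lambda>\<omega>. (Y1 \<omega>, Y2 \<omega>))"
      by (intro strongly_measurable_Pair LY Y)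
    obtain W' where W': "strongly_measurable M W'"
      and W'law: "distr M borel W' = distr M borel (\<lambda>\<omega>. (Y1 \<omega>, Y2 \<omega>))"
      and close: "AE \<omega> in M. norm (Y' \<omega> - h (W' \<omega>)) \<le> e"
      using lift_combination[OF U Ws Y's h _ e] law by (auto simp: h_def)
    have fst_snd: "fst \<in> borel_measurable (borel :: ('b \<times> 'b) measure)"
      "snd \<in> borel_measurable (borel :: ('b \<times> 'b) measure)"
      by (intro borel_measurable_continuous_onI continuous_intros)+
    have W1: "(\<lambda>\<omega>. fst (W' \<omega>)) \<in> same_law_class M Y1"
      using distr_eq_compose[OF W'law strongly_measurable_borel[OF W'] strongly_measurable_borel[OF Ws] fst_snd(1)]
        strongly_measurable_continuous[OF W', of fst]
      by (simp add: same_law_class_def continuous_on_fst)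
    have W2: "(\<lambda>\<omega>. snd (W' \<omega>)) \<in> same_law_class M Y2"
      using distr_eq_compose[OF W'law strongly_measurable_borel[OF W'] strongly_measurable_borel[OF Ws] fst_snd(2)]
        strongly_measurable_continuous[OF W', of snd]
      by (simp add: same_law_class_def continuous_on_snd)
    note int = bound(1)[OF Y(1) W1] bound(1)[OF Y(2) W2] bound(1)[OF comb_L[OF Y] Y']
    \<comment> \<open>The uniform error \<open>e\<close> enters as
      \<open>e * norm (Z \<omega>)\<close>, whose integral is exactly \<open>e\<close>.\<close>
    have "x \<le> (\<integral>\<omega>. a * Z \<omega> (fst (W' \<omega>)) + b * Z \<omega> (snd (W' \<omega>)) + e * norm (Z \<omega>) \<partial>M)"
      unfolding x_eq
    proof (rule integral_mono_AE)
      show "AE \<omega> in M. Z \<omega> (Y' \<omega>) \<le> a * Z \<omega> (fst (W' \<omega>)) + b * Z \<omega> (snd (W' \<omega>)) + e * norm (Z \<omega>)"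
        using close
      proof eventually_elim
        case (elim \<omega>)
        have "Z \<omega> (Y' \<omega> - h (W' \<omega>)) \<le> norm (Z \<omega>) * norm (Y' \<omega> - h (W' \<omega>))"
          using norm_blinfun[of "Z \<omega>" "Y' \<omega> - h (W' \<omega>)"] by simp
        also have "\<dots> \<le> norm (Z \<omega>) * e"
          using elim by (intro mult_left_mono) auto
        finally show ?case
          by (simp add: h_def blinfun.diff_right blinfun.add_right blinfun.scaleR_right mult.commute)
      qed
    qed (use int Zint in auto)
    also have "\<dots> = a * (\<integral>\<omega>. Z \<omega> (fst (W' \<omega>)) \<partial>M) + b * (\<integral>\<omega>. Z \<omega> (snd (W' \<omega>)) \<partial>M) + e"
      using int Zint one by simp
    also have "\<dots> \<le> a * rho M Z Y1 + b * rho M Z Y2 + e"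
      using ab rho_upper[OF Y(1) W1] rho_upper[OF Y(2) W2] by (intro add_mono mult_left_mono) auto
    finally show "x \<le> a * rho M Z Y1 + b * rho M Z Y2 + e" .
  qed
  have diff_L: "(\<lambda>\<omega>. Y1 \<omega> - Y2 \<omega>) \<in> L" if "Y1 \<in> L" "Y2 \<in> L" for Y1 Y2
    using comb_L[OF that, of 1 "-1"] by simp
  \<comment> \<open>Subadditivity is applied to \<open>Y1 = Y2 + (Y1 - Y2)\<close>, with
    \<open>rho_le\<close> bounding the second summand.\<close>
  have one_sided: "rho M Z Y1 - rho M Z Y2 \<le> enn2real (sigma_norm M ?\<sigma> p (\<lambda>\<omega>. Y1 \<omega> - Y2 \<omega>))"
    if "Y1 \<in> L" "Y2 \<in> L" for Y1 Y2
    using rho_comb[OF that(2) diff_L[OF that], of 1 1] rho_le[OF diff_L[OF that]] by simp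
  show ?thesis
  proof (intro conjI ballI impI)
    fix Y1 Y2 assume Y: "Y1 \<in> L" "Y2 \<in> L" and "AE \<omega> in M. Y1 \<omega> = Y2 \<omega>"
    then have "distr M borel Y1 = distr M borel Y2"
      by (intro distr_cong_AE) (auto intro: strongly_measurable_borel LY)
    then show "rho M Z Y1 = rho M Z Y2"
      by (simp add: rho_def rho_values_def same_law_class_def)
  next
    fix Y1 Y2 assume Y: "Y1 \<in> L" "Y2 \<in> L"
    show "(\<lambda>\<omega>. Y1 \<omega> + Y2 \<omega>) \<in> L" "rho M Z (\<lambda>\<omega>. Y1 \<omega> + Y2 \<omega>) \<le> rho M Z Y1 + rho M Z Y2"
      using comb_L[OF Y, of 1 1] rho_comb[OF Y, of 1 1] by simp_all
    \<comment> \<open>Symmetry of the norm lets the one-sided estimate with \<open>Y1\<close> and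
      \<open>Y2\<close> exchanged serve for the absolute value.\<close>
    have "sigma_norm M ?\<sigma> p (\<lambda>\<omega>. Y2 \<omega> - Y1 \<omega>) = sigma_norm M ?\<sigma> p (\<lambda>\<omega>. Y1 \<omega> - Y2 \<omega>)"
      unfolding sigma_norm_def sigma_norm_pow_def by (simp only: norm_minus_commute)
    then have "\<bar>rho M Z Y1 - rho M Z Y2\<bar> \<le> enn2real (sigma_norm M ?\<sigma> p (\<lambda>\<omega>. Y1 \<omega> - Y2 \<omega>))"
      using one_sided[OF Y] one_sided[OF Y(2) Y(1)]
      by (simp add: abs_le_iff)
    then have "ennreal \<bar>rho M Z Y1 - rho M Z Y2\<bar> \<le> ennreal (enn2real (sigma_norm M ?\<sigma> p (\<lambda>\<omega>. Y1 \<omega> - Y2 \<omega>)))"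
      by (rule ennreal_leI)
    also have "\<dots> = sigma_norm M ?\<sigma> p (\<lambda>\<omega>. Y1 \<omega> - Y2 \<omega>)"
      using LY(2)[OF diff_L[OF Y]] by simp
    finally show "ennreal \<bar>rho M Z Y1 - rho M Z Y2\<bar> \<le> sigma_norm M ?\<sigma> p (\<lambda>\<omega>. Y1 \<omega> - Y2 \<omega>)" .
  next
    fix Y1 Y2 and t :: real assume Y: "Y1 \<in> L" "Y2 \<in> L" and t: "t \<in> {0..1}"
    show "(\<lambda>\<omega>. (1 - t) *\<^sub>R Y1 \<omega> + t *\<^sub>R Y2 \<omega>) \<in> L"
      by (rule comb_L[OF Y])
    show "rho M Z (\<lambda>\<omega>. (1 - t) *\<^sub>R Y1 \<omega> + t *\<^sub>R Y2 \<omega>) \<le> (1 - t) * rho M Z Y1 + t * rho M Z Y2"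
      using t by (intro rho_comb[OF Y]) auto
  qed (use bound(1) ne bdd in auto)
qed

end
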